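(* Let $\Omega\subset\mathbb{C}$ be a bounded $n$-connected domain with $C^\infty$ smooth boundary, and let $\varphi$ be a positive real-valued $C^\infty$ function on $\partial\Omega$. Let $\{\varphi_k\}_{k=1}^\infty$ be a sequence of positive real-valued $C^\infty$ functions on $\partial\Omega$ such that $\varphi_k\to\varphi$ uniformly on $\partial\Omega$ as $k\to\infty$. Then $$\lim_{k\to\infty}S_{\varphi_k}(z,w)=S_\varphi(z,w)$$ locally uniformly on $\Omega\times\Omega$.
   Context: A bounded $n$-connected domain with $C^\infty$ smooth boundary is a bounded domain in $\mathbb{C}$ whose boundary consists of $n$ pairwise disjoint $C^\infty$ smooth simple closed curves. $ds$ is arc length on $\partial\Omega$. For a positive $C^\infty$ function $\varphi$ on $\partial\Omega$, $L^2_\varphi(\partial\Omega)$ is the Hilbert space of complex-valued functions on $\partial\Omega$ square integrable with respect to $\varphi\,ds$, with inner product $\langle u,v\rangle_\varphi=\int_{\partial\Omega}u\bar v\,\varphi\,ds$. $A^\infty(\Omega)$ is the space of holomorphic functions on $\Omega$ that are in $C^\infty(\overline\Omega)$; the Hardy space $H^2(\partial\Omega)$ is the closure in $L^2(\partial\Omega)$ (equivalently, in $L^2_\varphi(\partial\Omega)$) of the set of boundary values of functions in $A^\infty(\Omega)$, its elements $h$ being identified with holomorphic functions on $\Omega$ via $h(a)=\frac{1}{2\pi i}\int_{\partial\Omega}\frac{h(\zeta)}{\zeta-a}d\zeta$. For $a\in\Omega$, the weighted Szeg\H{o} kernel $S_\varphi(\cdot,a)\in H^2(\partial\Omega)$ is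 the unique function with $h(a)=\langle h,S_\varphi(\cdot,a)\rangle_\varphi$ for all $h\in H^2(\partial\Omega)$. *)

theory Defs
  imports "HOL-Complex_Analysis.Complex_Analysis"
begin

definition smooth :: "(real \<Rightarrow> 'a::real_normed_vector) \<Rightarrow> bool" where
  "smooth f \<longleftrightarrow> (\<forall>k t. ((\<lambda>g s. vector_derivative g (at s)) ^^ k) f differentiable (at t))"

text \<open>A smooth closed curve is given by a 1-periodic regular parametrization of the whole line, so
  that smoothness at the base point is included; \<^const>\<open>simple_path\<close> refers to its restriction to
  the period interval \<open>[0,1]\<close>.\<close>

definition smooth_simple_loop :: "(real \<Rightarrow> complex) \<Rightarrow> bool" where
  "smooth_simple_loop g \<longleftrightarrow>
     smooth g \<and> (\<forall>t. g (t + 1) = g t) \<and> (\<forall>t. vector_derivative g (at t) \<noteq> 0) \<and> simple_path g"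

definition boundary_parametrization :: "nat \<Rightarrow> complex set \<Rightarrow> (nat \<Rightarrow> real \<Rightarrow> complex) \<Rightarrow> bool" where
  "boundary_parametrization n \<Omega> \<gamma> \<longleftrightarrow>
     (\<forall>j<n. smooth_simple_loop (\<gamma> j)) \<and>
     disjoint_family_on (\<lambda>j. path_image (\<gamma> j)) {..<n} \<and>
     frontier \<Omega> = (\<Union>j<n. path_image (\<gamma> j))"

definition smooth_domain :: "nat \<Rightarrow> complex set \<Rightarrow> bool" where
  "smooth_domain n \<Omega> \<longleftrightarrow>
     open \<Omega> \<and> connected \<Omega> \<and> bounded \<Omega> \<and> \<Omega> \<noteq> {} \<and> (\<exists>\<gamma>. boundary_parametrization n \<Omega> \<gamma>)"

text \<open>Standard orientation: the domain lies to the left of every boundary curve, i.e. the normal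
  \<open>\<i> \<gamma>\<^sub>j'(t)\<close> points into \<open>\<Omega>\<close>.  Any boundary parametrization of a smooth domain can be given this
  orientation by reversing some of the curves.\<close>

definition oriented_boundary_parametrization ::
    "nat \<Rightarrow> complex set \<Rightarrow> (nat \<Rightarrow> real \<Rightarrow> complex) \<Rightarrow> bool" where
  "oriented_boundary_parametrization n \<Omega> \<gamma> \<longleftrightarrow>
     boundary_parametrization n \<Omega> \<gamma> \<and>
     (\<forall>j<n. \<forall>t. \<forall>\<^sub>F s in at_right 0.
        \<gamma> j t + complex_of_real s * (\<i> * vector_derivative (\<gamma> j) (at t)) \<in> \<Omega>)"

definition smooth_on_boundary :: "nat \<Rightarrow> (nat \<Rightarrow> real \<Rightarrow> complex) \<Rightarrow> (complex \<Rightarrow> real) \<Rightarrow> bool" where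
  "smooth_on_boundary n \<gamma> \<phi> \<longleftrightarrow> (\<forall>j<n. smooth (\<phi> \<circ> \<gamma> j))"

text \<open>Arc length \<open>ds\<close> as a Borel measure on the boundary: the image under \<open>(j, t) \<mapsto> \<gamma>\<^sub>j(t)\<close> of
  \<open>\<bar>\<gamma>\<^sub>j'(t)\<bar> dt\<close> on \<open>n\<close> copies of the period interval.\<close>

definition arclength :: "nat \<Rightarrow> (nat \<Rightarrow> real \<Rightarrow> complex) \<Rightarrow> complex measure" where
  "arclength n \<gamma> =
     distr (density (count_space {..<n} \<Otimes>\<^sub>M restrict_space lborel {0..<1})
             (\<lambda>(j, t). ennreal (norm (vector_derivative (\<gamma> j) (at t)))))
       (restrict_space borel (\<Union>j<n. path_image (\<gamma> j)))
       (\<lambda>(j, t). \<gamma> j t)"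

text \<open>Elements of \<open>L\<^sup>2\<close> and of the Hardy space are represented by functions, not by classes modulo
  equality almost everywhere.  Only values on the boundary matter.\<close>

definition L2 :: "nat \<Rightarrow> (nat \<Rightarrow> real \<Rightarrow> complex) \<Rightarrow> (complex \<Rightarrow> real) \<Rightarrow> (complex \<Rightarrow> complex) set" where
  "L2 n \<gamma> \<phi> = {u \<in> borel_measurable (arclength n \<gamma>).
                 integrable (arclength n \<gamma>) (\<lambda>z. (norm (u z))\<^sup>2 * \<phi> z)}"

definition L2_inner :: "nat \<Rightarrow> (nat \<Rightarrow> real \<Rightarrow> complex) \<Rightarrow> (complex \<Rightarrow> real) \<Rightarrow>
    (complex \<Rightarrow> complex) \<Rightarrow> (complex \<Rightarrow> complex) \<Rightarrow> complex" where
  "L2_inner n \<gamma> \<phi> u v = (LINT z|arclength n \<gamma>. u z * cnj (v z) * complex_of_real (\<phi> z))"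

definition L2_norm :: "nat \<Rightarrow> (nat \<Rightarrow> real \<Rightarrow> complex) \<Rightarrow> (complex \<Rightarrow> real) \<Rightarrow>
    (complex \<Rightarrow> complex) \<Rightarrow> real" where
  "L2_norm n \<gamma> \<phi> u = sqrt (LINT z|arclength n \<gamma>. (norm (u z))\<^sup>2 * \<phi> z)"

text \<open>\<open>C\<^sup>\<infinity>\<close> up to the boundary: \<open>D a b\<close> is the continuous extension to the closure of the partial
  derivative of order \<open>a\<close> in \<open>x\<close> and \<open>b\<close> in \<open>y\<close>.\<close>

definition smooth_on_closure :: "complex set \<Rightarrow> (complex \<Rightarrow> complex) \<Rightarrow> bool" where
  "smooth_on_closure \<Omega> f \<longleftrightarrow>
     (\<exists>D :: nat \<Rightarrow> nat \<Rightarrow> complex \<Rightarrow> complex.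
        (\<forall>z\<in>closure \<Omega>. D 0 0 z = f z) \<and>
        (\<forall>a b. continuous_on (closure \<Omega>) (D a b)) \<and>
        (\<forall>a b. \<forall>z\<in>\<Omega>. (D a b has_derivative
            (\<lambda>h. Re h *\<^sub>R D (Suc a) b z + Im h *\<^sub>R D a (Suc b) z)) (at z)))"

definition A_infinity :: "complex set \<Rightarrow> (complex \<Rightarrow> complex) set" where
  "A_infinity \<Omega> = {f. f holomorphic_on \<Omega> \<and> smooth_on_closure \<Omega> f}"

definition hardy_space :: "complex set \<Rightarrow> nat \<Rightarrow> (nat \<Rightarrow> real \<Rightarrow> complex) \<Rightarrow>
    (complex \<Rightarrow> complex) set" where
  "hardy_space \<Omega> n \<gamma> =
     {h \<in> L2 n \<gamma> (\<lambda>_. 1). \<forall>\<epsilon>>0. \<exists>f\<in>A_infinity \<Omega>. L2_norm n \<gamma> (\<lambda>_. 1) (\<lambda>z. h z - f z) < \<epsilon>}"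

definition cauchy_value :: "nat \<Rightarrow> (nat \<Rightarrow> real \<Rightarrow> complex) \<Rightarrow> (complex \<Rightarrow> complex) \<Rightarrow>
    complex \<Rightarrow> complex" where
  "cauchy_value n \<gamma> h a =
     1 / (2 * of_real pi * \<i>) * (\<Sum>j<n. contour_integral (\<gamma> j) (\<lambda>\<zeta>. h \<zeta> / (\<zeta> - a)))"

definition is_szego_kernel_at :: "complex set \<Rightarrow> nat \<Rightarrow> (nat \<Rightarrow> real \<Rightarrow> complex) \<Rightarrow>
    (complex \<Rightarrow> real) \<Rightarrow> complex \<Rightarrow> (complex \<Rightarrow> complex) \<Rightarrow> bool" where
  "is_szego_kernel_at \<Omega> n \<gamma> \<phi> a s \<longleftrightarrow>
     s \<in> hardy_space \<Omega> n \<gamma> \<and>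
     (\<forall>h\<in>hardy_space \<Omega> n \<gamma>. cauchy_value n \<gamma> h a = L2_inner n \<gamma> \<phi> h s)"

text \<open>The function selected by \<open>SOME\<close> is unique only up to equality almost everywhere on the
  boundary; this does not affect its Cauchy integral, which defines \<open>S\<^sub>\<phi>(z, a)\<close> for \<open>z \<in> \<Omega>\<close>.\<close>

definition szego_kernel :: "complex set \<Rightarrow> nat \<Rightarrow> (nat \<Rightarrow> real \<Rightarrow> complex) \<Rightarrow>
    (complex \<Rightarrow> real) \<Rightarrow> complex \<Rightarrow> complex \<Rightarrow> complex" where
  "szego_kernel \<Omega> n \<gamma> \<phi> z a = cauchy_value n \<gamma> (SOME s. is_szego_kernel_at \<Omega> n \<gamma> \<phi> a s) z"

end

theory Submission
  imports Defs
begin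

text \<open>The Szego kernel depends on the weight only through a Riesz representation, and Riesz
  representatives of a fixed functional are stable under small changes of the inner product.

  For \<open>a \<in> \<Omega>\<close> the evaluation \<open>E\<^sub>a h = h(a)\<close> is a Cauchy integral, hence a linear functional on
  \<open>L\<^sup>2\<close> of arc length.  Its norm is bounded by a constant \<open>K\<close> as long as \<open>a\<close> keeps a fixed distance
  from the boundary, and \<open>E\<^sub>a\<close> does not involve the weight.  A weight between two positive constants
  gives a norm equivalent to the unweighted one, so the Hardy space is complete for every such weight
  and a kernel \<open>S\<^sub>\<phi>(\<cdot>, a)\<close> representing \<open>E\<^sub>a\<close> exists (\<open>szego_kernel_exists\<close>).

  If \<open>\<phi>\<close> and \<open>\<psi>\<close> are at least \<open>c\<close> and differ by at most \<open>\<eta>\<close> on the boundary, the difference \<open>d\<close> of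
  the two kernels at \<open>a\<close> satisfies \<open>\<langle>d,d\<rangle>\<^sub>\<phi> = \<integral> d cnj(S\<^sub>\<psi>) (\<phi> - \<psi>) ds\<close>, because both kernels represent
  \<open>E\<^sub>a\<close>.  This leads to \<open>\<bar>S\<^sub>\<psi>(z,a) - S\<^sub>\<phi>(z,a)\<bar> \<le> (K/c)\<^sup>2 \<eta>\<close> (\<open>szego_kernel_weight_stability\<close>).
  The boundary is compact, so \<open>\<phi>\<close> has a positive minimum there, and uniform convergence gives a common
  lower bound \<open>c\<close> for \<open>\<phi>\<close> and all but finitely many \<open>\<phi>\<^sub>k\<close>; the constant \<open>K\<close> is uniform on small balls, and the
  convergence is locally uniform.\<close>

section \<open>Riesz representation for semi-inner products on spaces of functions\<close>

text \<open>Elements of \<open>L\<^sup>2\<close> are functions here, not classes modulo null sets, so the form is only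
  positive semidefinite.  A representing vector then exists
  but need not be unique.\<close>

locale semi_inner_functions =
  fixes H :: "('a \<Rightarrow> complex) set"
    and B :: "('a \<Rightarrow> complex) \<Rightarrow> ('a \<Rightarrow> complex) \<Rightarrow> complex"
  assumes zero_mem: "(\<lambda>_. 0) \<in> H"
    and add_mem: "\<And>f g. f \<in> H \<Longrightarrow> g \<in> H \<Longrightarrow> (\<lambda>x. f x + g x) \<in> H"
    and scale_mem: "\<And>f c. f \<in> H \<Longrightarrow> (\<lambda>x. c * f x) \<in> H"
    and B_add_left:
      "\<And>f g h. f \<in> H \<Longrightarrow> g \<in> H \<Longrightarrow> h \<in> H \<Longrightarrow> B (\<lambda>x. f x + g x) h = B f h + B g h"
    and B_scale_left: "\<And>f h c. f \<in> H \<Longrightarrow> h \<in> H \<Longrightarrow> B (\<lambda>x. c * f x) h = c * B f h"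
    and B_cnj: "\<And>f g. f \<in> H \<Longrightarrow> g \<in> H \<Longrightarrow> B g f = cnj (B f g)"
    and B_nonneg: "\<And>f. f \<in> H \<Longrightarrow> 0 \<le> Re (B f f)"
begin

definition seminorm :: "('a \<Rightarrow> complex) \<Rightarrow> real" where
  "seminorm f = sqrt (Re (B f f))"

lemma seminorm_nonneg: "f \<in> H \<Longrightarrow> 0 \<le> seminorm f"
  by (simp add: seminorm_def B_nonneg)

lemma seminorm_sq: "f \<in> H \<Longrightarrow> (seminorm f)\<^sup>2 = Re (B f f)"
  by (simp add: seminorm_def B_nonneg)

lemma diff_mem:
  assumes "f \<in> H" "g \<in> H" shows "(\<lambda>x. f x - g x) \<in> H"
  using add_mem[OF assms(1) scale_mem[OF assms(2), of "-1"]] by simp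

lemma B_diff_left:
  assumes "f \<in> H" "g \<in> H" "h \<in> H"
  shows "B (\<lambda>x. f x - g x) h = B f h - B g h"
  using B_add_left[OF assms(1) scale_mem[OF assms(2), of "-1"] assms(3)]
    B_scale_left[OF assms(2,3), of "-1"] by simp

lemma B_diff_right:
  assumes "f \<in> H" "g \<in> H" "h \<in> H"
  shows "B h (\<lambda>x. f x - g x) = B h f - B h g"
  unfolding B_cnj[OF diff_mem[OF assms(1,2)] assms(3)] B_cnj[OF assms(1,3)] B_cnj[OF assms(2,3)]
  by (simp add: B_diff_left assms)

lemma B_add_right:
  assumes "f \<in> H" "g \<in> H" "h \<in> H"
  shows "B h (\<lambda>x. f x + g x) = B h f + B h g"
  unfolding B_cnj[OF add_mem[OF assms(1,2)] assms(3)] B_cnj[OF assms(1,3)] B_cnj[OF assms(2,3)]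
  by (simp add: B_add_left assms)

lemma B_scale_right:
  assumes "f \<in> H" "h \<in> H"
  shows "B h (\<lambda>x. c * f x) = cnj c * B h f"
  unfolding B_cnj[OF scale_mem[OF assms(1)] assms(2)] B_cnj[OF assms(1,2)]
  by (simp add: B_scale_left assms)

lemma Re_B_sym: "f \<in> H \<Longrightarrow> g \<in> H \<Longrightarrow> Re (B g f) = Re (B f g)"
  by (subst B_cnj) simp_all

lemma Re_B_expand:
  fixes t :: real
  assumes f: "f \<in> H" and g: "g \<in> H"
  defines "u \<equiv> (\<lambda>x. f x + complex_of_real t * g x)"
  shows "Re (B u u) = Re (B f f) + 2 * t * Re (B f g) + t\<^sup>2 * Re (B g g)"
proof -
  note tg = scale_mem[OF g, of "complex_of_real t"]
  show ?thesis
    unfolding u_def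
    using f g tg add_mem[OF f tg] Re_B_sym[OF f g]
    by (simp add: B_add_left B_add_right B_scale_left B_scale_right algebra_simps power2_eq_square)
qed

lemma seminorm_scale: "f \<in> H \<Longrightarrow> seminorm (\<lambda>x. c * f x) = norm c * seminorm f"
proof -
  assume f: "f \<in> H"
  have "B (\<lambda>x. c * f x) (\<lambda>x. c * f x) = complex_of_real ((norm c)\<^sup>2) * B f f"
    using f scale_mem[OF f, of c]
    by (simp add: B_scale_left B_scale_right complex_norm_square algebra_simps del: of_real_power)
  then show ?thesis
    by (simp add: seminorm_def real_sqrt_mult del: of_real_power)
qed

lemma Cauchy_Schwarz_Re:
  assumes f: "f \<in> H" and g: "g \<in> H"
  shows "(Re (B f g))\<^sup>2 \<le> Re (B f f) * Re (B g g)"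
proof -
  have *: "0 \<le> Re (B f f) + 2 * t * Re (B f g) + t\<^sup>2 * Re (B g g)" for t
    using B_nonneg[OF add_mem[OF f scale_mem[OF g, of "complex_of_real t"]]]
      Re_B_expand[OF f g, of t] by simp
  show ?thesis
  proof (cases "Re (B g g) = 0")
    case True
    have "Re (B f g) = 0"
    proof (rule ccontr)
      assume n: "Re (B f g) \<noteq> 0"
      show False
        using *[of "- (Re (B f f) + 1) / (2 * Re (B f g))"] True n by (simp add: field_simps)
    qed
    with True show ?thesis by simp
  next
    case False
    then have p: "Re (B g g) > 0" using B_nonneg[OF g] by simp
    show ?thesis
      using *[of "- Re (B f g) / Re (B g g)"] p by (simp add: field_simps power2_eq_square)
  qed
qed

lemma Cauchy_Schwarz:
  assumes f: "f \<in> H" and g: "g \<in> H"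
  shows "norm (B f g) \<le> seminorm f * seminorm g"
proof -
  define c where "c = cnj (sgn (B f g))"
  have cB: "c * B f g = of_real (norm (B f g))"
    by (cases "B f g = 0")
      (simp_all add: c_def sgn_eq complex_norm_square[symmetric] power2_eq_square field_simps)
  have c1: "norm c \<le> 1" by (simp add: c_def norm_sgn)
  have cf: "(\<lambda>x. c * f x) \<in> H" by (rule scale_mem[OF f])
  have "(norm (B f g))\<^sup>2 = (Re (B (\<lambda>x. c * f x) g))\<^sup>2"
    using cB f g by (simp add: B_scale_left)
  also have "\<dots> \<le> (seminorm (\<lambda>x. c * f x) * seminorm g)\<^sup>2"
    using Cauchy_Schwarz_Re[OF cf g] by (simp add: power_mult_distrib seminorm_sq cf g)
  finally have "norm (B f g) \<le> seminorm (\<lambda>x. c * f x) * seminorm g"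
    by (rule power2_le_imp_le) (simp add: seminorm_nonneg cf g)
  also have "\<dots> \<le> seminorm f * seminorm g"
    using c1 by (intro mult_right_mono)
      (simp_all add: seminorm_scale f g seminorm_nonneg mult_left_le_one_le)
  finally show ?thesis .
qed

lemma seminorm_triangle:
  assumes f: "f \<in> H" and g: "g \<in> H"
  shows "seminorm (\<lambda>x. f x + g x) \<le> seminorm f + seminorm g"
proof (rule power2_le_imp_le)
  have "Re (B f g) \<le> seminorm f * seminorm g"
    using Cauchy_Schwarz[OF f g] complex_Re_le_cmod order_trans by blast
  then show "(seminorm (\<lambda>x. f x + g x))\<^sup>2 \<le> (seminorm f + seminorm g)\<^sup>2"
    using Re_B_expand[OF f g, of 1] f g add_mem[OF f g] by (simp add: seminorm_sq power2_sum)
qed (simp add: seminorm_nonneg f g)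

end

locale complete_semi_inner_functions = semi_inner_functions +
  assumes complete:
    "\<And>X. (\<And>n::nat. X n \<in> H) \<Longrightarrow>
       (\<And>e. e > 0 \<Longrightarrow> \<exists>N. \<forall>m\<ge>N. \<forall>n\<ge>N. seminorm (\<lambda>x. X m x - X n x) < e) \<Longrightarrow>
       \<exists>l\<in>H. (\<lambda>n. seminorm (\<lambda>x. X n x - l x)) \<longlonglongrightarrow> 0"
begin

text \<open>The representing vector minimises \<open>J h = B h h - 2 Re (E h)\<close>.  By the parallelogram law a
  minimising sequence is Cauchy; at its limit, the first variation of \<open>J\<close> in the direction \<open>h\<close> gives
  \<open>Re (B h s) = Re (E h)\<close>, and the direction \<open>\<i> h\<close> gives the imaginary parts.\<close>

lemma Riesz_representation:
  fixes E :: "('a \<Rightarrow> complex) \<Rightarrow> complex"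
  assumes E_add: "\<And>f g. f \<in> H \<Longrightarrow> g \<in> H \<Longrightarrow> E (\<lambda>x. f x + g x) = E f + E g"
    and E_scale: "\<And>f c. f \<in> H \<Longrightarrow> E (\<lambda>x. c * f x) = c * E f"
    and E_bound: "\<And>f. f \<in> H \<Longrightarrow> norm (E f) \<le> K * seminorm f"
  shows "\<exists>s\<in>H. \<forall>h\<in>H. E h = B h s"
proof -
  define J where "J = (\<lambda>h. Re (B h h) - 2 * Re (E h))"
  have J_ge: "- K\<^sup>2 \<le> J h" if "h \<in> H" for h
  proof -
    have "Re (E h) \<le> K * seminorm h"
      using E_bound[OF that] complex_Re_le_cmod order_trans by blast
    moreover have "0 \<le> (seminorm h - K)\<^sup>2" by simp
    ultimately show ?thesis
      using that by (simp add: J_def seminorm_sq[symmetric] power2_diff mult.commute)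
  qed
  have J_line: "J (\<lambda>x. f x + complex_of_real t * h x) =
      J f + 2 * t * (Re (B f h) - Re (E h)) + t\<^sup>2 * Re (B h h)"
    if "f \<in> H" "h \<in> H" for f h t
    using that scale_mem[OF that(2)] Re_B_expand[OF that, of t]
    by (simp add: J_def E_add E_scale algebra_simps)
  define m where "m = (INF h\<in>H. J h)"
  have bdd: "bdd_below (J ` H)" using J_ge by (intro bdd_belowI[of _ "- K\<^sup>2"]) auto
  have m_le: "m \<le> J h" if "h \<in> H" for h
    unfolding m_def by (rule cINF_lower[OF bdd that])
  have "\<exists>h\<in>H. J h < m + inverse (real (Suc n))" for n
  proof -
    have "(INF h\<in>H. J h) < m + inverse (real (Suc n))" by (simp add: m_def)
    then show ?thesis using cINF_less_iff[OF _ bdd] zero_mem by blast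
  qed
  then obtain X where XH: "\<And>n. X n \<in> H" and XJ: "\<And>n. J (X n) < m + inverse (real (Suc n))"
    by metis
  \<comment> \<open>The midpoint of \<open>f\<close> and \<open>g\<close> lies on the line through \<open>g\<close> in direction \<open>f - g\<close>, and \<open>J\<close> is at
    least \<open>m\<close> there.\<close>
  have parallelogram: "Re (B (\<lambda>x. f x - g x) (\<lambda>x. f x - g x)) \<le> 2 * (J f - m) + 2 * (J g - m)"
    if f: "f \<in> H" and g: "g \<in> H" for f g
  proof -
    define d where "d = (\<lambda>x. f x - g x)"
    have d: "d \<in> H" unfolding d_def by (rule diff_mem[OF f g])
    have e1: "f = (\<lambda>x. g x + complex_of_real 1 * d x)" by (simp add: d_def)
    have "J f = J g + 2 * (Re (B g d) - Re (E d)) + Re (B d d)"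
      using J_line[OF g d, of 1] by (subst e1) simp
    moreover have "m \<le> J g + (Re (B g d) - Re (E d)) + Re (B d d) / 4"
      using m_le[OF add_mem[OF g scale_mem[OF d, of "complex_of_real (1/2)"]]] J_line[OF g d, of "1/2"]
      by (simp add: power2_eq_square)
    ultimately show ?thesis unfolding d_def[symmetric] by simp
  qed
  have "\<exists>l\<in>H. (\<lambda>n. seminorm (\<lambda>x. X n x - l x)) \<longlonglongrightarrow> 0"
  proof (rule complete)
    fix e :: real assume "e > 0"
    then have "e\<^sup>2 / 4 > 0" by simp
    then obtain N where N: "inverse (real (Suc N)) < e\<^sup>2 / 4" using reals_Archimedean by blast
    have "seminorm (\<lambda>x. X i x - X j x) < e" if "i \<ge> N" "j \<ge> N" for i j
    proof (rule power2_less_imp_less)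
      have "inverse (real (Suc i)) \<le> inverse (real (Suc N))"
           "inverse (real (Suc j)) \<le> inverse (real (Suc N))"
        using that by (auto intro!: le_imp_inverse_le)
      then have "J (X i) - m < e\<^sup>2 / 4" "J (X j) - m < e\<^sup>2 / 4"
        using XJ[of i] XJ[of j] N by linarith+
      then show "(seminorm (\<lambda>x. X i x - X j x))\<^sup>2 < e\<^sup>2"
        using parallelogram[OF XH XH, of i j]
        unfolding seminorm_sq[OF diff_mem[OF XH XH]] by argo
    qed (use \<open>e > 0\<close> in simp)
    then show "\<exists>N. \<forall>i\<ge>N. \<forall>j\<ge>N. seminorm (\<lambda>x. X i x - X j x) < e" by blast
  qed (rule XH)
  then obtain l where l: "l \<in> H" and lim: "(\<lambda>n. seminorm (\<lambda>x. X n x - l x)) \<longlonglongrightarrow> 0" by blast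
  have J_l: "J l \<le> m"
  proof (rule LIMSEQ_le)
    define d where "d n = seminorm (\<lambda>x. X n x - l x)" for n
    show "(\<lambda>n. J l) \<longlonglongrightarrow> J l" by simp
    have "(\<lambda>n. m + inverse (real (Suc n)) + (2 * d n * (seminorm l + K))) \<longlonglongrightarrow> m + 0 + (2 * 0 * (seminorm l + K))"
      using lim unfolding d_def by (intro tendsto_intros LIMSEQ_inverse_real_of_nat)
    then show "(\<lambda>n. m + inverse (real (Suc n)) + (2 * d n * (seminorm l + K))) \<longlonglongrightarrow> m" by simp
    have "J l \<le> m + inverse (real (Suc n)) + (2 * d n * (seminorm l + K))" for n
    proof -
      define h where "h = (\<lambda>x. X n x - l x)"
      have h: "h \<in> H" unfolding h_def by (rule diff_mem[OF XH l])
      have e: "X n = (\<lambda>x. l x + complex_of_real 1 * h x)" by (simp add: h_def)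
      have "J (X n) = J l + 2 * (Re (B l h) - Re (E h)) + Re (B h h)"
        using J_line[OF l h, of 1] by (subst e) simp
      moreover have "- Re (B l h) \<le> seminorm l * seminorm h"
        using Cauchy_Schwarz[OF l h] abs_Re_le_cmod[of "B l h"] by linarith
      moreover have "Re (E h) \<le> K * seminorm h"
        using E_bound[OF h] complex_Re_le_cmod order_trans by blast
      moreover have "0 \<le> Re (B h h)" by (rule B_nonneg[OF h])
      ultimately show ?thesis using XJ[of n]
        unfolding d_def h_def[symmetric] by (simp add: algebra_simps)
    qed
    then show "\<exists>N. \<forall>n\<ge>N. J l \<le> m + inverse (real (Suc n)) + (2 * d n * (seminorm l + K))" by blast
  qed
  have Re_eq: "Re (B h l) = Re (E h)" if h: "h \<in> H" for h
  proof (rule ccontr)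
    define b where "b = Re (B l h) - Re (E h)"
    define q where "q = Re (B h h)"
    assume "Re (B h l) \<noteq> Re (E h)"
    then have b: "b \<noteq> 0" by (simp add: b_def Re_B_sym[OF l h])
    have q: "q \<ge> 0" unfolding q_def by (rule B_nonneg[OF h])
    have *: "0 \<le> 2 * t * b + t\<^sup>2 * q" for t
      using J_line[OF l h, of t] m_le[OF add_mem[OF l scale_mem[OF h, of "complex_of_real t"]]] J_l
      by (simp add: b_def q_def)
    \<comment> \<open>The minimiser of this quadratic in \<open>t\<close> is \<open>- b / q\<close>; the \<open>+ 1\<close> covers \<open>q = 0\<close>.\<close>
    have "2 * (- b / (q + 1)) * b + (- b / (q + 1))\<^sup>2 * q = - (b\<^sup>2 * (q + 2)) / (q + 1)\<^sup>2"
      using q by (simp add: power2_eq_square divide_simps) (simp add: algebra_simps)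
    moreover have "b\<^sup>2 * (q + 2) / (q + 1)\<^sup>2 > 0" using b q by simp
    ultimately show False using *[of "- b / (q + 1)"] by simp
  qed
  have "E h = B h l" if h: "h \<in> H" for h
  proof (rule complex_eqI)
    show "Re (E h) = Re (B h l)" using Re_eq[OF h] by simp
    have "Re (B (\<lambda>x. \<i> * h x) l) = Re (E (\<lambda>x. \<i> * h x))"
      by (rule Re_eq[OF scale_mem[OF h]])
    then show "Im (E h) = Im (B h l)" using h l by (simp add: B_scale_left E_scale)
  qed
  then show ?thesis using l by blast
qed

end

section \<open>Completeness of weighted square-integrable functions\<close>

definition square_integrable :: "'a measure \<Rightarrow> ('a \<Rightarrow> complex) set" where
  "square_integrable M = {u \<in> borel_measurable M. integrable M (\<lambda>x. (norm (u x))\<^sup>2)}"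

definition weighted_inner ::
    "'a measure \<Rightarrow> ('a \<Rightarrow> real) \<Rightarrow> ('a \<Rightarrow> complex) \<Rightarrow> ('a \<Rightarrow> complex) \<Rightarrow> complex" where
  "weighted_inner M w u v = (LINT x|M. u x * cnj (v x) * complex_of_real (w x))"

lemma square_integrableD:
  assumes "u \<in> square_integrable M"
  shows "u \<in> borel_measurable M" "integrable M (\<lambda>x. (norm (u x))\<^sup>2)"
  using assms by (auto simp: square_integrable_def)

lemma norm_add_sq_le: "(norm (a + b))\<^sup>2 \<le> 2 * (norm a)\<^sup>2 + 2 * (norm (b::complex))\<^sup>2"
proof -
  have "(norm (a + b))\<^sup>2 \<le> (norm a + norm b)\<^sup>2"
    by (intro power_mono norm_triangle_ineq norm_ge_zero)
  also have "\<dots> \<le> 2 * (norm a)\<^sup>2 + 2 * (norm b)\<^sup>2"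
    using zero_le_power2[of "norm a - norm b"] by (simp add: power2_sum power2_diff)
  finally show ?thesis .
qed

lemma square_integrable_zero: "(\<lambda>_. 0) \<in> square_integrable M"
  by (simp add: square_integrable_def)

lemma square_integrable_add:
  assumes u: "u \<in> square_integrable M" and v: "v \<in> square_integrable M"
  shows "(\<lambda>x. u x + v x) \<in> square_integrable M"
proof -
  note [measurable] = square_integrableD(1)[OF u] square_integrableD(1)[OF v]
  have "integrable M (\<lambda>x. 2 * (norm (u x))\<^sup>2 + 2 * (norm (v x))\<^sup>2)"
    using square_integrableD(2)[OF u] square_integrableD(2)[OF v] by simp
  then have "integrable M (\<lambda>x. (norm (u x + v x))\<^sup>2)"
    by (rule Bochner_Integration.integrable_bound) (auto intro!: AE_I2 norm_add_sq_le)
  then show ?thesis by (simp add: square_integrable_def)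
qed

lemma square_integrable_scale:
  assumes u: "u \<in> square_integrable M"
  shows "(\<lambda>x. c * u x) \<in> square_integrable M"
  using square_integrableD[OF u] by (simp add: square_integrable_def norm_mult power_mult_distrib)

lemma square_integrable_diff:
  assumes u: "u \<in> square_integrable M" and v: "v \<in> square_integrable M"
  shows "(\<lambda>x. u x - v x) \<in> square_integrable M"
  using square_integrable_add[OF u square_integrable_scale[OF v, of "-1"]] by simp

lemma (in finite_measure) square_integrable_imp_integrable:
  assumes u: "u \<in> square_integrable M"
  shows "integrable M u"
proof (rule Bochner_Integration.integrable_bound)
  show "integrable M (\<lambda>x. 1 + (norm (u x))\<^sup>2)"
    using square_integrableD(2)[OF u] by simp
  have "t \<le> 1 + t\<^sup>2" for t :: real
    using zero_le_power2[of "t - 1/2"] unfolding power2_diff by (simp add: power_divide)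
  then show "AE x in M. norm (u x) \<le> norm (1 + (norm (u x))\<^sup>2)"
    by (intro AE_I2) simp
qed (rule square_integrableD(1)[OF u])

text \<open>Along a fast subsequence \<open>r\<close> the successive differences have \<open>L\<^sup>2\<close> norms at most \<open>2\<^sup>-\<^sup>k\<close>.  As
  the measure is finite, their \<open>L\<^sup>1\<close> norms are summable as well, so the subsequence converges almost
  everywhere; Fatou's lemma turns this into convergence of the whole sequence in \<open>L\<^sup>2\<close>.\<close>

proposition (in finite_measure) Riesz_Fischer:
  fixes X :: "nat \<Rightarrow> 'a \<Rightarrow> complex"
  assumes X: "\<And>n. X n \<in> square_integrable M"
    and Cauchy: "\<And>e. e > 0 \<Longrightarrow> \<exists>N. \<forall>m\<ge>N. \<forall>n\<ge>N. (LINT x|M. (norm (X m x - X n x))\<^sup>2) < e"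
  shows "\<exists>l\<in>square_integrable M. (\<lambda>n. LINT x|M. (norm (X n x - l x))\<^sup>2) \<longlonglongrightarrow> 0"
proof -
  note [measurable] = square_integrableD(1)[OF X]
  have diff: "(\<lambda>x. X m x - X n x) \<in> square_integrable M" for m n
    by (rule square_integrable_diff[OF X X])
  have "\<exists>N. \<forall>m\<ge>N. \<forall>n\<ge>N. (LINT x|M. (norm (X m x - X n x))\<^sup>2) < (1/4) ^ k" for k
    by (rule Cauchy) simp
  then obtain N where N: "\<And>k m n. m \<ge> N k \<Longrightarrow> n \<ge> N k \<Longrightarrow>
      (LINT x|M. (norm (X m x - X n x))\<^sup>2) < (1/4) ^ k"
    by metis
  \<comment> \<open>The sum makes \<open>r\<close> dominate every threshold up to \<open>N k\<close>, and the summand \<open>k\<close> makes it unbounded.\<close>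
  define r where "r k = k + (\<Sum>i\<le>k. N i)" for k
  have r_ge: "r k \<ge> k" "r k \<ge> N k" "r (Suc k) \<ge> N k" for k
    using member_le_sum[of k "{..k}" N] by (auto simp: r_def)
  define d where "d k x = X (r (Suc k)) x - X (r k) x" for k x
  have [measurable]: "d k \<in> borel_measurable M" for k unfolding d_def by measurable
  have d_L1: "(\<integral>\<^sup>+x. ennreal (norm (d k x)) \<partial>M) \<le> ennreal ((measure M (space M) + 1) * (1/2) ^ k)" for k
  proof -
    have d2: "integrable M (\<lambda>x. (norm (d k x))\<^sup>2)"
      using square_integrableD(2)[OF diff] by (simp add: d_def)
    have "(\<integral>\<^sup>+x. ennreal (norm (d k x)) \<partial>M) \<le>
        (\<integral>\<^sup>+x. ennreal ((1/2) ^ k + 2 ^ k * (norm (d k x))\<^sup>2) \<partial>M)"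
    proof (intro nn_integral_mono ennreal_leI)
      fix x
      \<comment> \<open>The factors \<open>2\<^sup>-\<^sup>k\<close> and \<open>2\<^sup>k\<close> are chosen to give both terms an integral of order \<open>2\<^sup>-\<^sup>k\<close>,
        since \<open>\<bar>d k\<bar>\<^sup>2\<close> has integral at most \<open>4\<^sup>-\<^sup>k\<close>.\<close>
      have "0 \<le> (norm (d k x) * 2 ^ k - 1/2)\<^sup>2" by simp
      then have "norm (d k x) * 2 ^ k \<le> 1 + (2 ^ k)\<^sup>2 * (norm (d k x))\<^sup>2"
        unfolding power2_diff by (simp add: power_mult_distrib power2_eq_square mult_ac)
      then show "norm (d k x) \<le> (1/2) ^ k + 2 ^ k * (norm (d k x))\<^sup>2"
        by (simp add: field_simps power_one_over power2_eq_square)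
    qed
    also have "\<dots> = ennreal (LINT x|M. (1/2) ^ k + 2 ^ k * (norm (d k x))\<^sup>2)"
      using d2 by (intro nn_integral_eq_integral) (auto intro!: AE_I2)
    also have "(LINT x|M. (1/2) ^ k + 2 ^ k * (norm (d k x))\<^sup>2) =
        measure M (space M) * (1/2) ^ k + 2 ^ k * (LINT x|M. (norm (d k x))\<^sup>2)"
      using d2 by simp
    also have "\<dots> \<le> measure M (space M) * (1/2) ^ k + 2 ^ k * (1/4) ^ k"
      using N[of k "r (Suc k)" "r k"] r_ge by (auto simp: d_def intro!: less_imp_le)
    also have "2 ^ k * (1/4) ^ k = ((1/2) ^ k :: real)"
      by (simp add: power_mult_distrib[symmetric])
    finally show ?thesis by (simp add: algebra_simps ennreal_leI)
  qed
  have "(\<integral>\<^sup>+x. (\<Sum>k. ennreal (norm (d k x))) \<partial>M) = (\<Sum>k. \<integral>\<^sup>+x. ennreal (norm (d k x)) \<partial>M)"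
    by (rule nn_integral_suminf) measurable
  also have "\<dots> \<le> (\<Sum>k. ennreal ((measure M (space M) + 1) * (1/2) ^ k))"
    by (intro suminf_le d_L1) auto
  also have "\<dots> = ennreal (\<Sum>k. (measure M (space M) + 1) * (1/2) ^ k)"
    by (intro suminf_ennreal2) (auto intro!: summable_mult summable_geometric)
  also have "\<dots> < \<infinity>" by simp
  finally have "(\<integral>\<^sup>+x. (\<Sum>k. ennreal (norm (d k x))) \<partial>M) \<noteq> \<infinity>" by simp
  then have "AE x in M. (\<Sum>k. ennreal (norm (d k x))) \<noteq> \<infinity>"
    by (intro nn_integral_PInf_AE) measurable
  then have conv: "AE x in M. convergent (\<lambda>k. X (r k) x)"
  proof eventually_elim
    case (elim x)
    then have "summable (\<lambda>k. norm (d k x))" by (intro summable_suminf_not_top) auto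
    then have "summable (\<lambda>k. d k x)" by (rule summable_norm_cancel)
    then have "convergent (\<lambda>n. X (r 0) x + (\<Sum>k<n. d k x))"
      by (intro convergent_add convergent_const) (simp add: summable_iff_convergent)
    moreover have "X (r 0) x + (\<Sum>k<n. d k x) = X (r n) x" for n
      using sum_lessThan_telescope[of "\<lambda>k. X (r k) x" n] by (simp add: d_def)
    ultimately show ?case by simp
  qed
  define l where "l x = lim (\<lambda>k. X (r k) x)" for x
  have [measurable]: "l \<in> borel_measurable M" unfolding l_def by measurable
  have Fatou: "(\<integral>\<^sup>+x. ennreal ((norm (X n x - l x))\<^sup>2) \<partial>M) \<le> ennreal e"
    if le: "\<And>m. m \<ge> N \<Longrightarrow> (LINT x|M. (norm (X n x - X m x))\<^sup>2) \<le> e" for n N e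
  proof -
    have "(\<integral>\<^sup>+x. ennreal ((norm (X n x - l x))\<^sup>2) \<partial>M) =
        (\<integral>\<^sup>+x. liminf (\<lambda>k. ennreal ((norm (X n x - X (r k) x))\<^sup>2)) \<partial>M)"
    proof (rule nn_integral_cong_AE, use conv in eventually_elim)
      case (elim x)
      then have "(\<lambda>k. X (r k) x) \<longlonglongrightarrow> l x" by (simp add: l_def convergent_LIMSEQ_iff)
      then have "(\<lambda>k. ennreal ((norm (X n x - X (r k) x))\<^sup>2)) \<longlonglongrightarrow> ennreal ((norm (X n x - l x))\<^sup>2)"
        by (intro tendsto_intros)
      then show ?case by (intro lim_imp_Liminf[symmetric]) simp_all
    qed
    also have "\<dots> \<le> liminf (\<lambda>k. \<integral>\<^sup>+x. ennreal ((norm (X n x - X (r k) x))\<^sup>2) \<partial>M)"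
      by (rule nn_integral_liminf) measurable
    also have "\<dots> \<le> limsup (\<lambda>k. \<integral>\<^sup>+x. ennreal ((norm (X n x - X (r k) x))\<^sup>2) \<partial>M)"
      by (rule Liminf_le_Limsup) simp
    also have "\<dots> \<le> ennreal e"
    proof (rule Limsup_bounded)
      have "(\<integral>\<^sup>+x. ennreal ((norm (X n x - X (r k) x))\<^sup>2) \<partial>M) \<le> ennreal e" if "k \<ge> N" for k
        using le[of "r k"] r_ge(1)[of k] that square_integrableD(2)[OF diff]
        by (subst nn_integral_eq_integral) (auto intro!: ennreal_leI)
      then show "\<forall>\<^sub>F k in sequentially. (\<integral>\<^sup>+x. ennreal ((norm (X n x - X (r k) x))\<^sup>2) \<partial>M) \<le> ennreal e"
        by (auto simp: eventually_sequentially)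
    qed
    finally show ?thesis .
  qed
  have fin: "(\<lambda>x. X n x - l x) \<in> square_integrable M \<and> (LINT x|M. (norm (X n x - l x))\<^sup>2) \<le> e"
    if "\<And>m. m \<ge> N \<Longrightarrow> (LINT x|M. (norm (X n x - X m x))\<^sup>2) \<le> e" and "0 \<le> e" for n N e
  proof
    have F: "(\<integral>\<^sup>+x. ennreal ((norm (X n x - l x))\<^sup>2) \<partial>M) \<le> ennreal e"
      by (rule Fatou[OF that(1)])
    show "(\<lambda>x. X n x - l x) \<in> square_integrable M"
      unfolding square_integrable_def
      using F by (auto intro!: integrableI_bounded intro: le_less_trans)
    show "(LINT x|M. (norm (X n x - l x))\<^sup>2) \<le> e"
      using F \<open>0 \<le> e\<close> by (intro integral_real_bounded) auto
  qed
  obtain N1 where N1: "\<And>m n. m \<ge> N1 \<Longrightarrow> n \<ge> N1 \<Longrightarrow> (LINT x|M. (norm (X m x - X n x))\<^sup>2) < 1"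
    using Cauchy[of 1] by auto
  have "(\<lambda>x. X N1 x - l x) \<in> square_integrable M"
    using fin[of N1 N1 1] N1[of N1] by (auto intro: less_imp_le)
  from square_integrable_diff[OF X[of N1] this] have l: "l \<in> square_integrable M" by simp
  have "(\<lambda>n. LINT x|M. (norm (X n x - l x))\<^sup>2) \<longlonglongrightarrow> 0"
  proof (rule LIMSEQ_I)
    fix e :: real assume "e > 0"
    then obtain N where N: "\<And>m n. m \<ge> N \<Longrightarrow> n \<ge> N \<Longrightarrow> (LINT x|M. (norm (X m x - X n x))\<^sup>2) < e / 2"
      using Cauchy[of "e / 2"] by auto
    have "(LINT x|M. (norm (X n x - l x))\<^sup>2) \<le> e / 2" if "n \<ge> N" for n
      using fin[of N n "e / 2"] N[OF that] \<open>e > 0\<close> by (auto intro: less_imp_le)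
    then show "\<exists>N. \<forall>n\<ge>N. norm ((LINT x|M. (norm (X n x - l x))\<^sup>2) - 0) < e"
      using \<open>e > 0\<close> by (intro exI[of _ N]) force
  qed
  with l show ?thesis by blast
qed

text \<open>The bounds on the weight make the weighted norm equivalent to the unweighted one, so that one
  carrier set serves all weights.\<close>

locale weighted_measure = finite_measure M for M :: "'a measure" +
  fixes w :: "'a \<Rightarrow> real" and c C :: real
  assumes weight_measurable [measurable]: "w \<in> borel_measurable M"
    and c_pos: "0 < c"
    and weight_ge: "\<And>x. x \<in> space M \<Longrightarrow> c \<le> w x"
    and weight_le: "\<And>x. x \<in> space M \<Longrightarrow> w x \<le> C"
begin

lemma integrable_weighted_product:
  assumes u: "u \<in> square_integrable M" and v: "v \<in> square_integrable M"
  shows "integrable M (\<lambda>x. u x * cnj (v x) * complex_of_real (w x))"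
proof (rule Bochner_Integration.integrable_bound)
  note [measurable] = square_integrableD(1)[OF u] square_integrableD(1)[OF v]
  have [measurable]: "(\<lambda>x. cnj (v x)) \<in> borel_measurable M"
    by (rule borel_measurable_continuous_on[OF continuous_on_cnj[OF continuous_on_id]]) measurable
  have [measurable]: "(\<lambda>x. complex_of_real (w x)) \<in> borel_measurable M"
    by (rule borel_measurable_continuous_on[OF continuous_on_of_real[OF continuous_on_id]]) measurable
  show "integrable M (\<lambda>x. C * ((norm (u x))\<^sup>2 + (norm (v x))\<^sup>2))"
    using square_integrableD(2)[OF u] square_integrableD(2)[OF v] by simp
  show "(\<lambda>x. u x * cnj (v x) * complex_of_real (w x)) \<in> borel_measurable M"
    by measurable
  show "AE x in M. norm (u x * cnj (v x) * complex_of_real (w x)) \<le>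
      norm (C * ((norm (u x))\<^sup>2 + (norm (v x))\<^sup>2))"
  proof (rule AE_I2)
    fix x assume x: "x \<in> space M"
    have w: "0 \<le> w x" "w x \<le> C" using weight_ge[OF x] weight_le[OF x] c_pos by auto
    have "0 \<le> (norm (u x) - norm (v x))\<^sup>2" "0 \<le> norm (u x) * norm (v x)" by simp_all
    then have "norm (u x) * norm (v x) \<le> (norm (u x))\<^sup>2 + (norm (v x))\<^sup>2"
      unfolding power2_diff by linarith
    then have "(norm (u x) * norm (v x)) * w x \<le> ((norm (u x))\<^sup>2 + (norm (v x))\<^sup>2) * C"
      using w by (intro mult_mono) auto
    then show "norm (u x * cnj (v x) * complex_of_real (w x)) \<le>
      norm (C * ((norm (u x))\<^sup>2 + (norm (v x))\<^sup>2))"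
      using w by (simp add: norm_mult mult.commute)
  qed
qed

lemma self_product:
  "z * cnj z * complex_of_real t = complex_of_real ((norm z)\<^sup>2 * t)"
  unfolding of_real_mult complex_norm_square ..

lemma integrable_weighted_square:
  assumes u: "u \<in> square_integrable M"
  shows "integrable M (\<lambda>x. (norm (u x))\<^sup>2 * w x)"
  using integrable_Re[OF integrable_weighted_product[OF u u]]
  by (simp add: self_product del: of_real_mult)

lemma Re_weighted_inner_self: "Re (weighted_inner M w u u) = (LINT x|M. (norm (u x))\<^sup>2 * w x)"
proof -
  have "weighted_inner M w u u = (LINT x|M. complex_of_real ((norm (u x))\<^sup>2 * w x))"
    unfolding weighted_inner_def self_product ..
  also have "\<dots> = complex_of_real (LINT x|M. (norm (u x))\<^sup>2 * w x)"
    by (rule integral_complex_of_real)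
  finally show ?thesis by simp
qed

lemma weighted_square_bounds:
  assumes u: "u \<in> square_integrable M"
  shows "c * (LINT x|M. (norm (u x))\<^sup>2) \<le> Re (weighted_inner M w u u)"
    and "Re (weighted_inner M w u u) \<le> C * (LINT x|M. (norm (u x))\<^sup>2)"
proof -
  have "(LINT x|M. c * (norm (u x))\<^sup>2) \<le> (LINT x|M. (norm (u x))\<^sup>2 * w x)"
    using square_integrableD(2)[OF u] integrable_weighted_square[OF u] weight_ge
    by (intro integral_mono) (auto simp: mult.commute[of _ "w _"] intro!: mult_right_mono)
  then show "c * (LINT x|M. (norm (u x))\<^sup>2) \<le> Re (weighted_inner M w u u)"
    by (simp add: Re_weighted_inner_self)
  have "(LINT x|M. (norm (u x))\<^sup>2 * w x) \<le> (LINT x|M. C * (norm (u x))\<^sup>2)"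
    using square_integrableD(2)[OF u] integrable_weighted_square[OF u] weight_le
    by (intro integral_mono) (auto simp: mult.commute[of _ "w _"] intro!: mult_right_mono)
  then show "Re (weighted_inner M w u u) \<le> C * (LINT x|M. (norm (u x))\<^sup>2)"
    by (simp add: Re_weighted_inner_self)
qed

lemma semi_inner_functions_weighted:
  "semi_inner_functions (square_integrable M) (weighted_inner M w)"
proof
  fix f g h :: "'a \<Rightarrow> complex" and a :: complex
  assume f: "f \<in> square_integrable M"
  show "(\<lambda>x. a * f x) \<in> square_integrable M" by (rule square_integrable_scale[OF f])
  show "0 \<le> Re (weighted_inner M w f f)"
    using weighted_square_bounds(1)[OF f] c_pos
    by (intro order_trans[OF _ weighted_square_bounds(1)[OF f]])
      (auto intro!: mult_nonneg_nonneg Bochner_Integration.integral_nonneg)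
  show "weighted_inner M w (\<lambda>x. a * f x) h = a * weighted_inner M w f h"
    by (simp add: weighted_inner_def mult.assoc)
  show "weighted_inner M w g f = cnj (weighted_inner M w f g)"
    unfolding weighted_inner_def Bochner_Integration.integral_cnj[symmetric] by (simp add: mult_ac)
  assume g: "g \<in> square_integrable M"
  show "(\<lambda>x. f x + g x) \<in> square_integrable M" by (rule square_integrable_add[OF f g])
  assume h: "h \<in> square_integrable M"
  show "weighted_inner M w (\<lambda>x. f x + g x) h = weighted_inner M w f h + weighted_inner M w g h"
    using integrable_weighted_product[OF f h] integrable_weighted_product[OF g h]
    by (simp add: weighted_inner_def distrib_right)
qed (rule square_integrable_zero)

sublocale semi_inner_functions "square_integrable M" "weighted_inner M w"
  by (rule semi_inner_functions_weighted)

sublocale complete_semi_inner_functions "square_integrable M" "weighted_inner M w"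
proof
  fix X :: "nat \<Rightarrow> 'a \<Rightarrow> complex"
  assume X: "\<And>n. X n \<in> square_integrable M"
    and Cauchy: "\<And>e. e > 0 \<Longrightarrow> \<exists>N. \<forall>m\<ge>N. \<forall>n\<ge>N. seminorm (\<lambda>x. X m x - X n x) < e"
  have "\<exists>l\<in>square_integrable M. (\<lambda>n. LINT x|M. (norm (X n x - l x))\<^sup>2) \<longlonglongrightarrow> 0"
  proof (rule Riesz_Fischer[OF X])
    fix e :: real assume "e > 0"
    then have "sqrt (c * e) > 0" using c_pos by simp
    then obtain N where N: "\<And>m n. m \<ge> N \<Longrightarrow> n \<ge> N \<Longrightarrow> seminorm (\<lambda>x. X m x - X n x) < sqrt (c * e)"
      using Cauchy by meson
    have "(LINT x|M. (norm (X m x - X n x))\<^sup>2) < e" if "m \<ge> N" "n \<ge> N" for m n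
    proof -
      have "Re (weighted_inner M w (\<lambda>x. X m x - X n x) (\<lambda>x. X m x - X n x)) < c * e"
        using N[OF that] by (simp add: seminorm_def)
      with weighted_square_bounds(1)[OF diff_mem[OF X X], of m n]
      have "c * (LINT x|M. (norm (X m x - X n x))\<^sup>2) < c * e" by linarith
      then show ?thesis using c_pos by simp
    qed
    then show "\<exists>N. \<forall>m\<ge>N. \<forall>n\<ge>N. (LINT x|M. (norm (X m x - X n x))\<^sup>2) < e" by blast
  qed
  then obtain l where l: "l \<in> square_integrable M"
    and lim: "(\<lambda>n. LINT x|M. (norm (X n x - l x))\<^sup>2) \<longlonglongrightarrow> 0" by blast
  have "(\<lambda>n. seminorm (\<lambda>x. X n x - l x)) \<longlonglongrightarrow> 0"
  proof (rule tendsto_sandwich[OF _ _ tendsto_const])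
    have "(\<lambda>n. sqrt (C * (LINT x|M. (norm (X n x - l x))\<^sup>2))) \<longlonglongrightarrow> sqrt (C * 0)"
      by (intro tendsto_intros lim)
    then show "(\<lambda>n. sqrt (C * (LINT x|M. (norm (X n x - l x))\<^sup>2))) \<longlonglongrightarrow> 0" by simp
  qed (use weighted_square_bounds(2)[OF diff_mem[OF X l]] seminorm_nonneg[OF diff_mem[OF X l]]
       in \<open>auto simp: seminorm_def\<close>)
  with l show "\<exists>l\<in>square_integrable M. (\<lambda>n. seminorm (\<lambda>x. X n x - l x)) \<longlonglongrightarrow> 0" by blast
qed

end

section \<open>Arc length and the Cauchy integral\<close>

lemma smooth_imp_continuous_on:
  assumes "smooth f"
  shows "continuous_on S f" "continuous_on S (\<lambda>t. vector_derivative f (at t))"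
proof -
  have "((\<lambda>g s. vector_derivative g (at s)) ^^ k) f differentiable (at t)" for k t
    using assms by (auto simp: smooth_def)
  from this[of 0] this[of 1] show "continuous_on S f" "continuous_on S (\<lambda>t. vector_derivative f (at t))"
    by (auto intro!: continuous_at_imp_continuous_on differentiable_imp_continuous_within)
qed

locale boundary =
  fixes \<Omega> :: "complex set" and n :: nat and \<gamma> :: "nat \<Rightarrow> real \<Rightarrow> complex"
  assumes boundary: "boundary_parametrization n \<Omega> \<gamma>"
begin

abbreviation "ds \<equiv> arclength n \<gamma>"

abbreviation "period \<equiv> restrict_space lborel {0..<1::real}"

lemma smooth_curve: "j < n \<Longrightarrow> smooth (\<gamma> j)"
  using boundary by (auto simp: boundary_parametrization_def smooth_simple_loop_def)

lemma frontier_eq: "frontier \<Omega> = (\<Union>j<n. path_image (\<gamma> j))"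
  using boundary by (simp add: boundary_parametrization_def)

lemma curve_in_frontier: "j < n \<Longrightarrow> t \<in> {0..1} \<Longrightarrow> \<gamma> j t \<in> frontier \<Omega>"
  unfolding frontier_eq path_image_def by blast

lemma space_ds: "space ds = frontier \<Omega>"
  by (simp add: arclength_def space_restrict_space frontier_eq)

lemma sets_ds: "sets ds = sets (restrict_space borel (frontier \<Omega>))"
  by (simp add: arclength_def frontier_eq)

lemma compact_frontier: "compact (frontier \<Omega>)"
  unfolding frontier_eq
  by (intro compact_UN) (auto intro!: compact_path_image
    simp: path_def smooth_imp_continuous_on smooth_curve)

lemma continuous_imp_measurable_ds:
  assumes "continuous_on (frontier \<Omega>) (f :: complex \<Rightarrow> 'b::topological_space)"
  shows "f \<in> borel_measurable ds"
  using borel_measurable_continuous_on_restrict[OF assms] measurable_cong_sets[OF sets_ds refl] by blast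

text \<open>Smoothness is only known for the pull-backs of \<open>\<phi>\<close>.  Since a period interval is compact, each
  curve is a closed map onto its image, hence a quotient map, and continuity of the pull-back descends
  to the image.\<close>

lemma smooth_on_boundary_imp_continuous:
  assumes "smooth_on_boundary n \<gamma> \<phi>"
  shows "continuous_on (frontier \<Omega>) \<phi>"
  unfolding frontier_eq
proof (rule continuous_on_closed_Union)
  fix j assume j: "j \<in> {..<n}"
  have c: "continuous_on {0..1} (\<gamma> j)" "continuous_on {0..1} (\<phi> \<circ> \<gamma> j)"
    using j assms smooth_curve smooth_imp_continuous_on(1)
    unfolding smooth_on_boundary_def by blast+
  show "closed (path_image (\<gamma> j))"
    using c(1) by (simp add: closed_path_image path_def)
  show "continuous_on (path_image (\<gamma> j)) \<phi>"
    unfolding continuous_on_closed_vimage[OF \<open>closed (path_image (\<gamma> j))\<close>]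
  proof (intro allI impI)
    fix B :: "real set" assume "closed B"
    have "closed ((\<phi> \<circ> \<gamma> j) -` B \<inter> {0..1})"
      using c(2) \<open>closed B\<close> continuous_on_closed_vimage[of "{0..1::real}" "\<phi> \<circ> \<gamma> j"] by simp
    then have "compact (((\<phi> \<circ> \<gamma> j) -` B \<inter> {0..1}) \<inter> {0..1})"
      by (rule closed_Int_compact) simp
    then have "compact ((\<phi> \<circ> \<gamma> j) -` B \<inter> {0..1})"
      unfolding Int_assoc Int_absorb .
    then have "compact (\<gamma> j ` ((\<phi> \<circ> \<gamma> j) -` B \<inter> {0..1}))"
      by (intro compact_continuous_image continuous_on_subset[OF c(1)]) auto
    moreover have "\<gamma> j ` ((\<phi> \<circ> \<gamma> j) -` B \<inter> {0..1}) = \<phi> -` B \<inter> path_image (\<gamma> j)"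
      by (auto simp: path_image_def)
    ultimately show "closed (\<phi> -` B \<inter> path_image (\<gamma> j))"
      by (metis compact_imp_closed)
  qed
qed simp

lemma measurable_speed [measurable]:
  "(\<lambda>(j, t). norm (vector_derivative (\<gamma> j) (at t))) \<in>
     borel_measurable (count_space {..<n} \<Otimes>\<^sub>M period)"
  by (intro measurable_pair_measure_countable1)
    (auto intro!: measurable_restrict_space1 borel_measurable_continuous_onI continuous_on_norm
      smooth_imp_continuous_on(2) smooth_curve)

lemma measurable_curve: "j < n \<Longrightarrow> \<gamma> j \<in> measurable period (restrict_space borel (frontier \<Omega>))"
  by (intro measurable_restrict_space2 measurable_restrict_space1)
    (auto intro!: borel_measurable_continuous_onI smooth_imp_continuous_on smooth_curve
       curve_in_frontier simp: space_restrict_space)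

lemma measurable_curves [measurable]:
  "(\<lambda>(j, t). \<gamma> j t) \<in> measurable (count_space {..<n} \<Otimes>\<^sub>M period) (restrict_space borel (frontier \<Omega>))"
  by (intro measurable_pair_measure_countable1) (auto intro!: measurable_curve)

lemma sigma_finite_period: "sigma_finite_measure period"
  by (intro sigma_finite_measure_restrict_space sigma_finite_lborel) simp_all

lemma arclength_eq:
  "ds = distr (density (count_space {..<n} \<Otimes>\<^sub>M period)
             (\<lambda>p. ennreal ((\<lambda>(j, t). norm (vector_derivative (\<gamma> j) (at t))) p)))
       (restrict_space borel (frontier \<Omega>)) (\<lambda>(j, t). \<gamma> j t)"
  unfolding arclength_def frontier_eq by (simp add: case_prod_beta')

lemma finite_measure_ds: "finite_measure ds"
proof (rule finite_measureI)
  interpret period: sigma_finite_measure period by (rule sigma_finite_period)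
  have bound: "\<exists>K. \<forall>t\<in>{0..1}. norm (vector_derivative (\<gamma> j) (at t)) \<le> K" if "j < n" for j
  proof -
    have "compact ((\<lambda>t. vector_derivative (\<gamma> j) (at t)) ` {0..1})"
      by (intro compact_continuous_image smooth_imp_continuous_on smooth_curve that) simp
    then show ?thesis by (auto dest!: compact_imp_bounded simp: bounded_iff)
  qed
  have "emeasure ds (space ds) = (\<integral>\<^sup>+z. 1 \<partial>ds)" by simp
  also have "\<dots> =
    (\<integral>\<^sup>+p. ennreal ((\<lambda>(j, t). norm (vector_derivative (\<gamma> j) (at t))) p) \<partial>(count_space {..<n} \<Otimes>\<^sub>M period))"
    unfolding arclength_eq using measurable_curves
    by (subst nn_integral_distr) (simp_all add: nn_integral_density del: nn_integral_const)
  also have "\<dots> = (\<Sum>j<n. \<integral>\<^sup>+t. ennreal (norm (vector_derivative (\<gamma> j) (at t))) \<partial>period)"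
    by (subst period.nn_integral_fst[symmetric]) (simp_all add: nn_integral_count_space_finite)
  also have "\<dots> < \<infinity>"
    unfolding infinity_ennreal_def ennreal_sum_less_top[OF finite_lessThan]
  proof
    fix j assume "j \<in> {..<n}"
    then obtain K where K: "\<And>t. t \<in> {0..1} \<Longrightarrow> norm (vector_derivative (\<gamma> j) (at t)) \<le> K"
      using bound[of j] by blast
    have "(\<integral>\<^sup>+t. ennreal (norm (vector_derivative (\<gamma> j) (at t))) \<partial>period) \<le> (\<integral>\<^sup>+t. ennreal K \<partial>period)"
      by (intro nn_integral_mono ennreal_leI K) (auto simp: space_restrict_space)
    also have "\<dots> < top" by (simp add: emeasure_restrict_space space_restrict_space)
    finally show "(\<integral>\<^sup>+t. ennreal (norm (vector_derivative (\<gamma> j) (at t))) \<partial>period) < top" .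
  qed
  finally show "emeasure ds (space ds) \<noteq> \<infinity>" by simp
qed

sublocale finite_measure ds by (rule finite_measure_ds)

lemma measurable_pullback:
  assumes "u \<in> borel_measurable ds" "j < n"
  shows "(\<lambda>t. u (\<gamma> j t)) \<in> borel_measurable period"
  using measurable_comp[OF measurable_curve[OF assms(2)], of u] assms(1)
    measurable_cong_sets[OF sets_ds refl] by (auto simp: o_def)

lemma integral_arclength:
  fixes u :: "complex \<Rightarrow> real"
  assumes u: "integrable ds u"
  shows "j < n \<Longrightarrow> integrable period (\<lambda>t. norm (vector_derivative (\<gamma> j) (at t)) * u (\<gamma> j t))"
    and "(LINT z|ds. u z) =
           (\<Sum>j<n. LINT t|period. norm (vector_derivative (\<gamma> j) (at t)) * u (\<gamma> j t))"
proof -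
  let ?P = "count_space {..<n} \<Otimes>\<^sub>M period"
  let ?\<gamma> = "\<lambda>(j, t). \<gamma> j t"
  let ?v = "\<lambda>(j, t). norm (vector_derivative (\<gamma> j) (at t))"
  interpret pair_sigma_finite "count_space {..<n}" period
    by (intro pair_sigma_finite.intro sigma_finite_period sigma_finite_measure_count_space_finite) simp
  have um: "u \<in> borel_measurable (restrict_space borel (frontier \<Omega>))"
    using borel_measurable_integrable[OF u] measurable_cong_sets[OF sets_ds refl] by blast
  then have [measurable]: "(\<lambda>p. u (?\<gamma> p)) \<in> borel_measurable ?P"
    by (rule measurable_compose[OF measurable_curves])
  have \<gamma>m: "?\<gamma> \<in> measurable (density ?P (\<lambda>p. ennreal (?v p))) (restrict_space borel (frontier \<Omega>))"
    using measurable_curves by simp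
  have nonneg: "AE p in ?P. 0 \<le> ?v p" by (intro AE_I2) auto
  have "integrable (density ?P (\<lambda>p. ennreal (?v p))) (\<lambda>p. u (?\<gamma> p))"
    using u unfolding arclength_eq integrable_distr_eq[OF \<gamma>m um] .
  then have int: "integrable ?P (\<lambda>p. ?v p *\<^sub>R u (?\<gamma> p))"
    by (subst (asm) integrable_density[OF _ _ nonneg]) simp_all
  have "AE j in count_space {..<n}. integrable period (\<lambda>t. ?v (j, t) *\<^sub>R u (?\<gamma> (j, t)))"
    by (rule AE_integrable_fst'[OF int])
  then show "j < n \<Longrightarrow> integrable period (\<lambda>t. norm (vector_derivative (\<gamma> j) (at t)) * u (\<gamma> j t))"
    by (simp add: AE_count_space)
  have "(LINT z|ds. u z) = (LINT p|density ?P (\<lambda>p. ennreal (?v p)). u (?\<gamma> p))"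
    unfolding arclength_eq by (rule integral_distr[OF \<gamma>m um])
  also have "\<dots> = (LINT p|?P. ?v p *\<^sub>R u (?\<gamma> p))"
    by (rule integral_density[OF _ _ nonneg]) simp_all
  also have "\<dots> = (LINT j|count_space {..<n}. LINT t|period. ?v (j, t) *\<^sub>R u (?\<gamma> (j, t)))"
    by (rule integral_fst'[OF int, symmetric])
  also have "\<dots> = (\<Sum>j<n. LINT t|period. norm (vector_derivative (\<gamma> j) (at t)) * u (\<gamma> j t))"
    by (simp add: lebesgue_integral_count_space_finite)
  finally show "(LINT z|ds. u z) =
           (\<Sum>j<n. LINT t|period. norm (vector_derivative (\<gamma> j) (at t)) * u (\<gamma> j t))" .
qed

text \<open>The contour integral is a gauge integral over \<open>[0,1]\<close>, while arc length lives on \<open>[0,1)\<close> so that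
  the base point is counted once; the two differ by a negligible point.  As \<open>\<bar>d\<zeta>\<bar> = ds\<close>, integrability
  against arc length is enough for the contour integral to exist, which makes the Cauchy integral
  linear on all of \<open>L\<^sup>2\<close>.\<close>

lemma contour_integral_arclength:
  fixes u :: "complex \<Rightarrow> complex"
  assumes u: "integrable ds u" and j: "j < n"
  shows "u contour_integrable_on \<gamma> j"
    and "norm (contour_integral (\<gamma> j) u) \<le>
           (LINT t|period. norm (vector_derivative (\<gamma> j) (at t)) * norm (u (\<gamma> j t)))"
proof -
  let ?f = "\<lambda>t. u (\<gamma> j t) * vector_derivative (\<gamma> j) (at t)"
  have "(\<lambda>t. vector_derivative (\<gamma> j) (at t)) \<in> borel_measurable period"
    by (auto intro!: measurable_restrict_space1 borel_measurable_continuous_onI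
        smooth_imp_continuous_on smooth_curve j)
  then have "?f \<in> borel_measurable period"
    using measurable_pullback[OF borel_measurable_integrable[OF u] j] by measurable
  with integral_arclength(1)[OF integrable_norm[OF u] j]
  have int: "integrable period ?f"
    by (rule Bochner_Integration.integrable_bound) (auto intro!: AE_I2 simp: norm_mult mult.commute)
  then have set_int: "set_integrable lborel {0..<1} ?f"
    by (simp add: integrable_restrict_space set_integrable_def)
  have spike: "negligible ({0..<1} - {0..1::real})" "negligible ({0..1} - {0..<1::real})"
  proof -
    have "{0..1} - {0..<1} = {1::real}" "{0..<1} - {0..1} = ({}::real set)" by auto
    then show "negligible ({0..<1} - {0..1::real})" "negligible ({0..1} - {0..<1::real})" by simp_all
  qed
  have "?f integrable_on {0..<1}"
    by (rule set_borel_integral_eq_integral(1)[OF set_int])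
  then show "u contour_integrable_on \<gamma> j"
    unfolding contour_integrable_on
    by (rule integrable_spike_set) (auto intro: negligible_subset[OF spike(1)] negligible_subset[OF spike(2)])
  have "contour_integral (\<gamma> j) u = integral {0..<1} ?f"
    unfolding contour_integral_integral
    by (rule integral_spike_set) (auto intro: negligible_subset[OF spike(1)] negligible_subset[OF spike(2)])
  also have "\<dots> = (LINT t:{0..<1}|lborel. ?f t)"
    by (rule set_borel_integral_eq_integral(2)[OF set_int, symmetric])
  also have "\<dots> = (LINT t|period. ?f t)"
    by (simp add: integral_restrict_space set_lebesgue_integral_def)
  finally have "norm (contour_integral (\<gamma> j) u) \<le> (LINT t|period. norm (?f t))"
    by simp
  then show "norm (contour_integral (\<gamma> j) u) \<le>
           (LINT t|period. norm (vector_derivative (\<gamma> j) (at t)) * norm (u (\<gamma> j t)))"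
    by (simp add: norm_mult mult.commute)
qed

lemma integrable_Cauchy_kernel:
  assumes h: "h \<in> square_integrable ds" and r: "r > 0" "\<And>\<zeta>. \<zeta> \<in> frontier \<Omega> \<Longrightarrow> r \<le> dist \<zeta> a"
  shows "integrable ds (\<lambda>\<zeta>. h \<zeta> / (\<zeta> - a))"
    and "\<And>\<zeta>. \<zeta> \<in> frontier \<Omega> \<Longrightarrow> norm (h \<zeta> / (\<zeta> - a)) \<le> norm (h \<zeta>) / r"
proof -
  show le: "norm (h \<zeta> / (\<zeta> - a)) \<le> norm (h \<zeta>) / r" if "\<zeta> \<in> frontier \<Omega>" for \<zeta>
    using r(2)[OF that] r(1) by (simp add: norm_divide dist_norm frac_le)
  have meas: "(\<lambda>\<zeta>. h \<zeta> / (\<zeta> - a)) \<in> borel_measurable ds"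
    using square_integrableD(1)[OF h]
      continuous_imp_measurable_ds[of "\<lambda>\<zeta>. \<zeta> - a", OF continuous_on_diff[OF continuous_on_id continuous_on_const]]
    by measurable
  have int: "integrable ds (\<lambda>\<zeta>. norm (h \<zeta>) / r)"
    using square_integrable_imp_integrable[OF h] by simp
  have "AE \<zeta> in ds. norm (h \<zeta> / (\<zeta> - a)) \<le> norm (norm (h \<zeta>) / r)"
    using r(1) le by (intro AE_I2) (simp add: space_ds)
  then show "integrable ds (\<lambda>\<zeta>. h \<zeta> / (\<zeta> - a))"
    by (rule Bochner_Integration.integrable_bound[OF int meas])
qed

lemma norm_cauchy_value_le:
  assumes h: "h \<in> square_integrable ds" and r: "r > 0" "\<And>\<zeta>. \<zeta> \<in> frontier \<Omega> \<Longrightarrow> r \<le> dist \<zeta> a"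
  shows "norm (cauchy_value n \<gamma> h a) \<le> (LINT \<zeta>|ds. norm (h \<zeta>)) / (2 * pi * r)"
proof -
  let ?u = "\<lambda>\<zeta>. h \<zeta> / (\<zeta> - a)"
  note u = integrable_Cauchy_kernel[OF h r]
  have "norm (\<Sum>j<n. contour_integral (\<gamma> j) ?u) \<le>
      (\<Sum>j<n. LINT t|period. norm (vector_derivative (\<gamma> j) (at t)) * norm (?u (\<gamma> j t)))"
    by (intro order_trans[OF norm_sum] sum_mono contour_integral_arclength(2)[OF u(1)]) simp_all
  also have "\<dots> = (LINT \<zeta>|ds. norm (?u \<zeta>))"
    by (rule integral_arclength(2)[OF integrable_norm[OF u(1)], symmetric])
  also have "\<dots> \<le> (LINT \<zeta>|ds. norm (h \<zeta>) / r)"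
    using u square_integrable_imp_integrable[OF h]
    by (intro integral_mono) (auto simp: space_ds)
  also have "\<dots> = (LINT \<zeta>|ds. norm (h \<zeta>)) / r" by simp
  finally show ?thesis
    unfolding cauchy_value_def using r(1)
    by (simp add: norm_mult norm_divide divide_simps mult_ac)
qed

lemma cauchy_value_add:
  assumes "f \<in> square_integrable ds" "g \<in> square_integrable ds"
    and "r > 0" "\<And>\<zeta>. \<zeta> \<in> frontier \<Omega> \<Longrightarrow> r \<le> dist \<zeta> a"
  shows "cauchy_value n \<gamma> (\<lambda>x. f x + g x) a = cauchy_value n \<gamma> f a + cauchy_value n \<gamma> g a"
proof -
  note c = contour_integral_arclength(1)[OF integrable_Cauchy_kernel(1)]
  have "contour_integral (\<gamma> j) (\<lambda>\<zeta>. (f \<zeta> + g \<zeta>) / (\<zeta> - a)) =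
      contour_integral (\<gamma> j) (\<lambda>\<zeta>. f \<zeta> / (\<zeta> - a)) + contour_integral (\<gamma> j) (\<lambda>\<zeta>. g \<zeta> / (\<zeta> - a))"
    if "j < n" for j
    unfolding add_divide_distrib
    by (rule contour_integral_add[OF c[OF assms(1,3,4) that] c[OF assms(2,3,4) that]])
  then show ?thesis
    by (simp add: cauchy_value_def sum.distrib distrib_left add_divide_distrib)
qed

lemma cauchy_value_scale:
  assumes "f \<in> square_integrable ds"
    and "r > 0" "\<And>\<zeta>. \<zeta> \<in> frontier \<Omega> \<Longrightarrow> r \<le> dist \<zeta> a"
  shows "cauchy_value n \<gamma> (\<lambda>x. c * f x) a = c * cauchy_value n \<gamma> f a"
proof -
  have "contour_integral (\<gamma> j) (\<lambda>\<zeta>. c * f \<zeta> / (\<zeta> - a)) =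
      c * contour_integral (\<gamma> j) (\<lambda>\<zeta>. f \<zeta> / (\<zeta> - a))" if "j < n" for j
    unfolding times_divide_eq_right[symmetric]
    by (rule contour_integral_lmul[OF contour_integral_arclength(1)[OF integrable_Cauchy_kernel(1)[OF assms] that]])
  then show ?thesis
    by (simp add: cauchy_value_def sum_distrib_left mult_ac)
qed

end

section \<open>The Hardy space as a closed subspace\<close>

lemma (in complete_semi_inner_functions) complete_closed_subspace:
  assumes sub: "K \<subseteq> H" and zero: "(\<lambda>_. 0) \<in> K"
    and add: "\<And>f g. f \<in> K \<Longrightarrow> g \<in> K \<Longrightarrow> (\<lambda>x. f x + g x) \<in> K"
    and scale: "\<And>f a. f \<in> K \<Longrightarrow> (\<lambda>x. a * f x) \<in> K"
    and closed: "\<And>X l. (\<And>k::nat. X k \<in> K) \<Longrightarrow> l \<in> H \<Longrightarrow>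
                   (\<lambda>k. seminorm (\<lambda>x. X k x - l x)) \<longlonglongrightarrow> 0 \<Longrightarrow> l \<in> K"
  shows "complete_semi_inner_functions K B"
proof -
  interpret K: semi_inner_functions K B
    using sub by unfold_locales (auto intro: zero add scale B_nonneg B_add_left B_scale_left B_cnj)
  show ?thesis
  proof
    fix X :: "nat \<Rightarrow> 'a \<Rightarrow> complex"
    assume X: "\<And>k. X k \<in> K"
      and Cauchy: "\<And>e. e > 0 \<Longrightarrow> \<exists>N. \<forall>i\<ge>N. \<forall>j\<ge>N. seminorm (\<lambda>x. X i x - X j x) < e"
    have "\<exists>l\<in>H. (\<lambda>k. seminorm (\<lambda>x. X k x - l x)) \<longlonglongrightarrow> 0"
      using X sub Cauchy by (intro complete) auto
    then obtain l where l: "l \<in> H" and lim: "(\<lambda>k. seminorm (\<lambda>x. X k x - l x)) \<longlonglongrightarrow> 0" by blast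
    then show "\<exists>l\<in>K. (\<lambda>k. seminorm (\<lambda>x. X k x - l x)) \<longlonglongrightarrow> 0"
      using closed[of X, OF X l lim] by blast
  qed
qed

lemma smooth_on_closure_imp_continuous:
  assumes "smooth_on_closure \<Omega> f"
  shows "continuous_on (closure \<Omega>) f"
proof -
  obtain D :: "nat \<Rightarrow> nat \<Rightarrow> complex \<Rightarrow> complex" where "\<forall>z\<in>closure \<Omega>. D 0 0 z = f z"
    "\<forall>a b. continuous_on (closure \<Omega>) (D a b)"
    using assms unfolding smooth_on_closure_def by blast
  moreover from this(1) have "continuous_on (closure \<Omega>) (D 0 0) = continuous_on (closure \<Omega>) f"
    by (intro continuous_on_cong) auto
  ultimately show ?thesis by blast
qed

lemma A_infinity_zero: "(\<lambda>_. 0) \<in> A_infinity \<Omega>"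
  unfolding A_infinity_def smooth_on_closure_def
  by (auto intro!: exI[of _ "\<lambda>_ _ _. 0"])

lemma A_infinity_add:
  assumes "f \<in> A_infinity \<Omega>" "g \<in> A_infinity \<Omega>"
  shows "(\<lambda>z. f z + g z) \<in> A_infinity \<Omega>"
proof -
  obtain D where D: "\<And>z. z \<in> closure \<Omega> \<Longrightarrow> D 0 0 z = f z"
    "\<And>a b. continuous_on (closure \<Omega>) (D a b)"
    "\<And>a b z. z \<in> \<Omega> \<Longrightarrow>
       (D a b has_derivative (\<lambda>h. Re h *\<^sub>R D (Suc a) b z + Im h *\<^sub>R D a (Suc b) z)) (at z)"
    using assms(1) unfolding A_infinity_def smooth_on_closure_def by blast
  obtain D' where D': "\<And>z. z \<in> closure \<Omega> \<Longrightarrow> D' 0 0 z = g z"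
    "\<And>a b. continuous_on (closure \<Omega>) (D' a b)"
    "\<And>a b z. z \<in> \<Omega> \<Longrightarrow>
       (D' a b has_derivative (\<lambda>h. Re h *\<^sub>R D' (Suc a) b z + Im h *\<^sub>R D' a (Suc b) z)) (at z)"
    using assms(2) unfolding A_infinity_def smooth_on_closure_def by blast
  have "((\<lambda>z. D a b z + D' a b z) has_derivative (\<lambda>h. Re h *\<^sub>R (D (Suc a) b z + D' (Suc a) b z) +
      Im h *\<^sub>R (D a (Suc b) z + D' a (Suc b) z))) (at z)" if "z \<in> \<Omega>" for a b z
    using has_derivative_add[OF D(3)[OF that, of a b] D'(3)[OF that, of a b]]
    by (rule has_derivative_eq_rhs) (simp add: fun_eq_iff scaleR_add_right)
  then have "smooth_on_closure \<Omega> (\<lambda>z. f z + g z)"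
    unfolding smooth_on_closure_def
    by (intro exI[of _ "\<lambda>a b z. D a b z + D' a b z"]) (auto intro: continuous_on_add D D' simp: D(1) D'(1))
  then show ?thesis
    using assms by (auto simp: A_infinity_def intro: holomorphic_on_add)
qed

lemma A_infinity_scale:
  assumes "f \<in> A_infinity \<Omega>"
  shows "(\<lambda>z. c * f z) \<in> A_infinity \<Omega>"
proof -
  obtain D where D: "\<And>z. z \<in> closure \<Omega> \<Longrightarrow> D 0 0 z = f z"
    "\<And>a b. continuous_on (closure \<Omega>) (D a b)"
    "\<And>a b z. z \<in> \<Omega> \<Longrightarrow>
       (D a b has_derivative (\<lambda>h. Re h *\<^sub>R D (Suc a) b z + Im h *\<^sub>R D a (Suc b) z)) (at z)"
    using assms(1) unfolding A_infinity_def smooth_on_closure_def by blast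
  have "((\<lambda>z. c * D a b z) has_derivative (\<lambda>h. Re h *\<^sub>R (c * D (Suc a) b z) +
      Im h *\<^sub>R (c * D a (Suc b) z))) (at z)" if "z \<in> \<Omega>" for a b z
    using has_derivative_mult_right[OF D(3)[OF that, of a b], of c]
    by (rule has_derivative_eq_rhs) (simp add: fun_eq_iff distrib_left)
  then have "smooth_on_closure \<Omega> (\<lambda>z. c * f z)"
    unfolding smooth_on_closure_def
    by (intro exI[of _ "\<lambda>a b z. c * D a b z"]) (auto intro: continuous_on_mult_left D simp: D(1))
  then show ?thesis
    using assms by (auto simp: A_infinity_def intro: holomorphic_on_mult)
qed

context boundary
begin

abbreviation "hardy \<equiv> hardy_space \<Omega> n \<gamma>"

abbreviation "L2n \<equiv> L2_norm n \<gamma> (\<lambda>_. 1)"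

sublocale unweighted: weighted_measure ds "\<lambda>_. 1" 1 1
  by unfold_locales auto

lemma L2n_eq: "L2n = unweighted.seminorm"
  by (simp add: fun_eq_iff L2_norm_def unweighted.seminorm_def unweighted.Re_weighted_inner_self)

lemma L2n_sq: "(L2n u)\<^sup>2 = (LINT z|ds. (norm (u z))\<^sup>2)"
  by (simp add: L2_norm_def Bochner_Integration.integral_nonneg)

lemma L2_eq: "L2 n \<gamma> (\<lambda>_. 1) = square_integrable ds"
  by (simp add: L2_def square_integrable_def)

lemma hardy_L2: "h \<in> hardy \<Longrightarrow> h \<in> square_integrable ds"
  by (simp add: hardy_space_def L2_eq)

lemma hardy_approx: "h \<in> hardy \<Longrightarrow> e > 0 \<Longrightarrow> \<exists>f\<in>A_infinity \<Omega>. L2n (\<lambda>z. h z - f z) < e"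
  by (simp add: hardy_space_def)

lemma A_infinity_L2:
  assumes "f \<in> A_infinity \<Omega>" shows "f \<in> square_integrable ds"
proof -
  have cont: "continuous_on (frontier \<Omega>) f"
    using assms smooth_on_closure_imp_continuous
    by (auto simp: A_infinity_def frontier_def intro: continuous_on_subset)
  have "bounded (f ` frontier \<Omega>)"
    by (intro compact_imp_bounded compact_continuous_image cont compact_frontier)
  then obtain K where K: "\<And>z. z \<in> frontier \<Omega> \<Longrightarrow> norm (f z) \<le> K" by (auto simp: bounded_iff)
  have [measurable]: "f \<in> borel_measurable ds" by (rule continuous_imp_measurable_ds[OF cont])
  have "integrable ds (\<lambda>z. (norm (f z))\<^sup>2)"
    by (rule integrable_const_bound[of _ "K\<^sup>2"]) (auto intro!: AE_I2 power_mono K simp: space_ds)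
  then show ?thesis by (simp add: square_integrable_def)
qed

lemma hardy_closed:
  assumes X: "\<And>k::nat. X k \<in> hardy" and l: "l \<in> square_integrable ds"
    and lim: "(\<lambda>k. L2n (\<lambda>z. X k z - l z)) \<longlonglongrightarrow> 0"
  shows "l \<in> hardy"
  unfolding hardy_space_def L2_eq
proof (intro CollectI conjI allI impI l)
  fix e :: real assume "e > 0"
  then have "e / 2 > 0" by simp
  then obtain k where k: "L2n (\<lambda>z. X k z - l z) < e / 2"
    using eventually_happens'[OF sequentially_bot order_tendstoD(2)[OF lim \<open>e / 2 > 0\<close>]] by blast
  obtain f where f: "f \<in> A_infinity \<Omega>" "L2n (\<lambda>z. X k z - f z) < e / 2"
    using hardy_approx[OF X \<open>e / 2 > 0\<close>] by blast
  have d: "(\<lambda>z. X k z - l z) \<in> square_integrable ds" "(\<lambda>z. X k z - f z) \<in> square_integrable ds"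
    by (intro square_integrable_diff hardy_L2 X l A_infinity_L2 f)+
  have "L2n (\<lambda>z. l z - f z) = L2n (\<lambda>z. -1 * (X k z - l z) + (X k z - f z))" by simp
  also have "\<dots> \<le> L2n (\<lambda>z. -1 * (X k z - l z)) + L2n (\<lambda>z. X k z - f z)"
    unfolding L2n_eq by (intro unweighted.seminorm_triangle square_integrable_scale d)
  also have "L2n (\<lambda>z. -1 * (X k z - l z)) = L2n (\<lambda>z. X k z - l z)"
    using unweighted.seminorm_scale[OF d(1), of "-1"] by (simp add: L2n_eq)
  finally show "\<exists>f\<in>A_infinity \<Omega>. L2n (\<lambda>z. l z - f z) < e"
    using k f by (intro bexI[of _ f]) linarith
qed

lemma A_infinity_hardy: "f \<in> A_infinity \<Omega> \<Longrightarrow> f \<in> hardy"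
  unfolding hardy_space_def L2_eq
  by (auto intro!: A_infinity_L2 bexI[of _ f] simp: L2_norm_def)

lemma hardy_add:
  assumes g: "g \<in> hardy" and h: "h \<in> hardy"
  shows "(\<lambda>z. g z + h z) \<in> hardy"
  unfolding hardy_space_def L2_eq
proof (intro CollectI conjI allI impI square_integrable_add hardy_L2 g h)
  fix e :: real assume "e > 0"
  then have "e / 2 > 0" by simp
  obtain p q where p: "p \<in> A_infinity \<Omega>" "L2n (\<lambda>z. g z - p z) < e / 2"
    and q: "q \<in> A_infinity \<Omega>" "L2n (\<lambda>z. h z - q z) < e / 2"
    using hardy_approx[OF g \<open>e / 2 > 0\<close>] hardy_approx[OF h \<open>e / 2 > 0\<close>] by blast
  have "L2n (\<lambda>z. g z + h z - (p z + q z)) = L2n (\<lambda>z. (g z - p z) + (h z - q z))"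
    by (simp add: algebra_simps)
  also have "\<dots> \<le> L2n (\<lambda>z. g z - p z) + L2n (\<lambda>z. h z - q z)"
    unfolding L2n_eq
    by (intro unweighted.seminorm_triangle square_integrable_diff hardy_L2 g h A_infinity_L2 p q)
  finally show "\<exists>f\<in>A_infinity \<Omega>. L2n (\<lambda>z. g z + h z - f z) < e"
    using p q A_infinity_add by (intro bexI[of _ "\<lambda>z. p z + q z"]) auto
qed

lemma hardy_scale:
  assumes h: "h \<in> hardy"
  shows "(\<lambda>z. c * h z) \<in> hardy"
  unfolding hardy_space_def L2_eq
proof (intro CollectI conjI allI impI square_integrable_scale hardy_L2 h)
  fix e :: real assume "e > 0"
  then have "e / (norm c + 1) > 0" by (simp add: add_nonneg_pos)
  then obtain p where p: "p \<in> A_infinity \<Omega>" "L2n (\<lambda>z. h z - p z) < e / (norm c + 1)"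
    using hardy_approx[OF h] by blast
  have d: "(\<lambda>z. h z - p z) \<in> square_integrable ds"
    by (intro square_integrable_diff hardy_L2 h A_infinity_L2 p)
  have "L2n (\<lambda>z. c * h z - c * p z) = norm c * L2n (\<lambda>z. h z - p z)"
    using unweighted.seminorm_scale[OF d, of c] by (simp add: L2n_eq right_diff_distrib)
  also have "\<dots> \<le> (norm c + 1) * L2n (\<lambda>z. h z - p z)"
    using unweighted.seminorm_nonneg[OF d] by (intro mult_right_mono) (simp_all add: L2n_eq)
  also have "\<dots> < e"
    using p(2) by (simp add: pos_less_divide_eq add_nonneg_pos mult.commute)
  finally show "\<exists>f\<in>A_infinity \<Omega>. L2n (\<lambda>z. c * h z - f z) < e"
    using p A_infinity_scale by (intro bexI[of _ "\<lambda>z. c * p z"]) auto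
qed

lemma hardy_diff:
  assumes g: "g \<in> hardy" and h: "h \<in> hardy"
  shows "(\<lambda>z. g z - h z) \<in> hardy"
  using hardy_add[OF g hardy_scale[OF h, of "-1"]] by simp

section \<open>Existence of the kernel and its dependence on the weight\<close>

lemma L1_le_L2:
  assumes h: "h \<in> square_integrable ds"
  shows "(LINT z|ds. norm (h z)) \<le> sqrt (measure ds (space ds)) * L2n h"
proof -
  have abs: "(\<lambda>z. complex_of_real (norm (h z))) \<in> square_integrable ds"
    using square_integrableD[OF h] by (simp add: square_integrable_def)
  have one: "(\<lambda>_. 1) \<in> square_integrable ds"
    by (simp add: square_integrable_def)
  have "norm (weighted_inner ds (\<lambda>_. 1) (\<lambda>z. complex_of_real (norm (h z))) (\<lambda>_. 1)) \<le>
     unweighted.seminorm (\<lambda>z. complex_of_real (norm (h z))) * unweighted.seminorm (\<lambda>_. 1)"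
    by (rule unweighted.Cauchy_Schwarz[OF abs one])
  moreover have "weighted_inner ds (\<lambda>_. 1) (\<lambda>z. complex_of_real (norm (h z))) (\<lambda>_. 1) =
      complex_of_real (LINT z|ds. norm (h z))"
    by (simp add: weighted_inner_def)
  moreover have "unweighted.seminorm (\<lambda>z. complex_of_real (norm (h z))) = L2n h"
    "unweighted.seminorm (\<lambda>_. 1) = sqrt (measure ds (space ds))"
    by (simp_all add: L2n_eq[symmetric] L2_norm_def)
  ultimately show ?thesis by (simp add: mult.commute)
qed

text \<open>A bound for the norm of evaluation at a point of distance at least \<open>r\<close> from the boundary: the
  Cauchy kernel is at most \<open>1 / (2 \<pi> r)\<close> on the boundary, and the square root comes
  from comparing the \<open>L\<^sup>1\<close> and \<open>L\<^sup>2\<close> norms.  It depends neither on the point nor on the weight.\<close>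

definition Cauchy_bound :: "real \<Rightarrow> real" where
  "Cauchy_bound r = sqrt (measure ds (space ds)) / (2 * pi * r)"

lemma cauchy_value_L2_bound:
  assumes h: "h \<in> square_integrable ds" and r: "r > 0" "\<And>\<zeta>. \<zeta> \<in> frontier \<Omega> \<Longrightarrow> r \<le> dist \<zeta> a"
  shows "norm (cauchy_value n \<gamma> h a) \<le> Cauchy_bound r * L2n h"
proof -
  have "norm (cauchy_value n \<gamma> h a) \<le> (LINT \<zeta>|ds. norm (h \<zeta>)) / (2 * pi * r)"
    by (rule norm_cauchy_value_le[OF h r])
  also have "\<dots> \<le> sqrt (measure ds (space ds)) * L2n h / (2 * pi * r)"
    using r(1) by (intro divide_right_mono L1_le_L2[OF h]) simp
  finally show ?thesis by (simp add: Cauchy_bound_def)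
qed

text \<open>The Hardy space is defined by the unweighted norm.  It is closed in the weighted norm because
  the two norms are equivalent, so the Riesz theorem applies to the weighted inner product.\<close>

lemma szego_kernel_exists:
  assumes w: "weighted_measure ds \<phi> c C"
    and r: "r > 0" "\<And>\<zeta>. \<zeta> \<in> frontier \<Omega> \<Longrightarrow> r \<le> dist \<zeta> a"
  shows "\<exists>s. is_szego_kernel_at \<Omega> n \<gamma> \<phi> a s"
proof -
  interpret w: weighted_measure ds \<phi> c C by (rule w)
  have L2n_le: "L2n h \<le> w.seminorm h / sqrt c" if "h \<in> square_integrable ds" for h
  proof -
    have "L2n h = sqrt (LINT z|ds. (norm (h z))\<^sup>2)" by (simp add: L2_norm_def)
    also have "\<dots> \<le> sqrt (Re (weighted_inner ds \<phi> h h) / c)"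
      using w.weighted_square_bounds(1)[OF that] w.c_pos by (simp add: field_simps)
    finally show ?thesis by (simp add: w.seminorm_def real_sqrt_divide)
  qed
  interpret hardy: complete_semi_inner_functions hardy "weighted_inner ds \<phi>"
  proof (rule w.complete_closed_subspace)
    fix X :: "nat \<Rightarrow> complex \<Rightarrow> complex" and l
    assume X: "\<And>k. X k \<in> hardy" and l: "l \<in> square_integrable ds"
      and lim: "(\<lambda>k. w.seminorm (\<lambda>x. X k x - l x)) \<longlonglongrightarrow> 0"
    have d: "(\<lambda>x. X k x - l x) \<in> square_integrable ds" for k
      by (intro square_integrable_diff hardy_L2 X l)
    have "(\<lambda>k. L2n (\<lambda>x. X k x - l x)) \<longlonglongrightarrow> 0"
    proof (rule tendsto_sandwich[OF _ _ tendsto_const])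
      show "(\<lambda>k. w.seminorm (\<lambda>x. X k x - l x) / sqrt c) \<longlonglongrightarrow> 0"
        using tendsto_divide[OF lim tendsto_const[of "sqrt c"]] w.c_pos by simp
    qed (use L2n_le[OF d] unweighted.seminorm_nonneg[OF d] in \<open>simp_all add: L2n_eq\<close>)
    then show "l \<in> hardy" by (rule hardy_closed[OF X l])
  qed (auto intro: hardy_L2 hardy_add hardy_scale A_infinity_hardy A_infinity_zero)
  have "\<exists>s\<in>hardy. \<forall>h\<in>hardy. cauchy_value n \<gamma> h a = weighted_inner ds \<phi> h s"
  proof (rule hardy.Riesz_representation)
    fix h assume h: "h \<in> hardy"
    have "norm (cauchy_value n \<gamma> h a) \<le> Cauchy_bound r * L2n h"
      by (rule cauchy_value_L2_bound[OF hardy_L2[OF h] r])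
    also have "\<dots> \<le> Cauchy_bound r * (w.seminorm h / sqrt c)"
      using r(1) by (intro mult_left_mono L2n_le hardy_L2 h) (simp add: Cauchy_bound_def)
    finally show "norm (cauchy_value n \<gamma> h a) \<le> Cauchy_bound r / sqrt c * w.seminorm h" by simp
  qed (use cauchy_value_add[OF hardy_L2 hardy_L2 r] cauchy_value_scale[OF hardy_L2 r] in auto)
  then show ?thesis
    by (auto simp: is_szego_kernel_at_def L2_inner_def weighted_inner_def)
qed

text \<open>Let \<open>s\<close> and \<open>t\<close> represent evaluation at \<open>a\<close> for the weights \<open>\<phi>\<close> and \<open>\<psi>\<close>, let \<open>d = t - s\<close>, and
  let \<open>K\<close> bound evaluations at \<open>a\<close> and \<open>z\<close>.  Both representations give the same value at \<open>d\<close>, whence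
  \<open>\<langle>d,d\<rangle>\<^sub>\<phi> = \<langle>d,t\<rangle>\<^sub>\<phi> - \<langle>d,t\<rangle>\<^sub>\<psi> = \<integral> d cnj(t) (\<phi> - \<psi>) ds\<close>.  With \<open>\<phi> \<ge> c\<close> this bounds \<open>\<parallel>d\<parallel>\<close> by
  \<open>\<eta> \<parallel>t\<parallel> / c\<close>.  Testing the representation of \<open>t\<close> against \<open>t\<close> itself gives \<open>\<parallel>t\<parallel> \<le> K / c\<close>, and
  evaluating \<open>d\<close> at \<open>z\<close> costs another factor \<open>K\<close>.  The bound holds for whichever representing
  functions the definition selects, since they enter only through these identities.\<close>

lemma szego_kernel_weight_stability:
  assumes wp: "weighted_measure ds \<phi> c C" and wq: "weighted_measure ds \<psi> c C"
    and close: "\<And>\<zeta>. \<zeta> \<in> frontier \<Omega> \<Longrightarrow> \<bar>\<phi> \<zeta> - \<psi> \<zeta>\<bar> \<le> \<eta>"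
    and r: "r > 0" "\<And>\<zeta>. \<zeta> \<in> frontier \<Omega> \<Longrightarrow> r \<le> dist \<zeta> a" "\<And>\<zeta>. \<zeta> \<in> frontier \<Omega> \<Longrightarrow> r \<le> dist \<zeta> z"
    and \<eta>: "\<eta> \<ge> 0"
  shows "norm (szego_kernel \<Omega> n \<gamma> \<psi> z a - szego_kernel \<Omega> n \<gamma> \<phi> z a) \<le> (Cauchy_bound r / c)\<^sup>2 * \<eta>"
proof -
  interpret p: weighted_measure ds \<phi> c C by (rule wp)
  interpret q: weighted_measure ds \<psi> c C by (rule wq)
  define s where "s = (SOME s. is_szego_kernel_at \<Omega> n \<gamma> \<phi> a s)"
  define t where "t = (SOME s. is_szego_kernel_at \<Omega> n \<gamma> \<psi> a s)"
  have "is_szego_kernel_at \<Omega> n \<gamma> \<phi> a s" "is_szego_kernel_at \<Omega> n \<gamma> \<psi> a t"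
    unfolding s_def t_def using szego_kernel_exists[OF wp r(1,2)] szego_kernel_exists[OF wq r(1,2)]
    by (simp_all add: some_eq_ex)
  then have s: "s \<in> hardy" and t: "t \<in> hardy"
    and Es: "\<And>h. h \<in> hardy \<Longrightarrow> cauchy_value n \<gamma> h a = weighted_inner ds \<phi> h s"
    and Et: "\<And>h. h \<in> hardy \<Longrightarrow> cauchy_value n \<gamma> h a = weighted_inner ds \<psi> h t"
    by (auto simp: is_szego_kernel_at_def L2_inner_def weighted_inner_def)
  define K where "K = Cauchy_bound r"
  have K: "K \<ge> 0" using r(1) by (simp add: K_def Cauchy_bound_def)
  define d where "d = (\<lambda>x. t x - s x)"
  have d: "d \<in> hardy" unfolding d_def by (rule hardy_diff[OF t s])
  note L2 = hardy_L2[OF s] hardy_L2[OF t] hardy_L2[OF d]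
  have nonneg: "L2n h \<ge> 0" if "h \<in> square_integrable ds" for h
    using unweighted.seminorm_nonneg[OF that] by (simp add: L2n_eq)
  have cancel: "x \<le> b / c" if "c * x\<^sup>2 \<le> b * x" "x \<ge> 0" "b \<ge> 0" for x b :: real
    using that p.c_pos by (cases "x = 0") (auto simp: power2_eq_square field_simps)
  have t_bound: "L2n t \<le> K / c"
  proof (rule cancel)
    have "c * (L2n t)\<^sup>2 \<le> Re (weighted_inner ds \<psi> t t)"
      using q.weighted_square_bounds(1)[OF L2(2)] by (simp add: L2n_sq)
    also have "\<dots> \<le> norm (cauchy_value n \<gamma> t a)"
      by (simp add: Et[OF t] complex_Re_le_cmod)
    also have "\<dots> \<le> K * L2n t"
      unfolding K_def by (rule cauchy_value_L2_bound[OF L2(2) r(1,2)])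
    finally show "c * (L2n t)\<^sup>2 \<le> K * L2n t" .
  qed (use K nonneg L2 in auto)
  have d_bound: "L2n d \<le> \<eta> * L2n t / c"
  proof (rule cancel)
    have abs_L2: "(\<lambda>x. complex_of_real (norm (u x))) \<in> square_integrable ds"
      if "u \<in> square_integrable ds" for u
      using square_integrableD[OF that] by (simp add: square_integrable_def)
    have int: "integrable ds (\<lambda>x. norm (d x) * norm (t x))"
      using integrable_Re[OF unweighted.integrable_weighted_product[OF abs_L2[OF L2(3)] abs_L2[OF L2(2)]]]
      by simp
    have "c * (L2n d)\<^sup>2 \<le> Re (weighted_inner ds \<phi> d d)"
      using p.weighted_square_bounds(1)[OF L2(3)] by (simp add: L2n_sq)
    also have "weighted_inner ds \<phi> d d = weighted_inner ds \<phi> d t - weighted_inner ds \<phi> d s"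
      unfolding d_def by (rule p.B_diff_right[OF L2(2,1)]) (use L2(3) in \<open>simp add: d_def\<close>)
    also have "weighted_inner ds \<phi> d s = weighted_inner ds \<psi> d t"
      using Es[OF d] Et[OF d] by simp
    also have "weighted_inner ds \<phi> d t - weighted_inner ds \<psi> d t =
        (LINT x|ds. d x * cnj (t x) * complex_of_real (\<phi> x - \<psi> x))"
      unfolding weighted_inner_def Bochner_Integration.integral_diff[symmetric,
          OF p.integrable_weighted_product[OF L2(3,2)] q.integrable_weighted_product[OF L2(3,2)]]
      by (simp add: right_diff_distrib)
    also have "Re \<dots> \<le> norm \<dots>" by (rule complex_Re_le_cmod)
    also have "\<dots> \<le> (LINT x|ds. \<eta> * (norm (d x) * norm (t x)))"
    proof (rule Bochner_Integration.integral_norm_bound_integral)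
      show "integrable ds (\<lambda>x. d x * cnj (t x) * complex_of_real (\<phi> x - \<psi> x))"
        using Bochner_Integration.integrable_diff[OF p.integrable_weighted_product[OF L2(3,2)]
            q.integrable_weighted_product[OF L2(3,2)]] by (simp add: algebra_simps)
      show "integrable ds (\<lambda>x. \<eta> * (norm (d x) * norm (t x)))" using int by simp
      fix x assume "x \<in> space ds"
      then have "norm (d x) * norm (t x) * \<bar>\<phi> x - \<psi> x\<bar> \<le> norm (d x) * norm (t x) * \<eta>"
        by (intro mult_left_mono close) (simp_all add: space_ds)
      then show "norm (d x * cnj (t x) * complex_of_real (\<phi> x - \<psi> x)) \<le> \<eta> * (norm (d x) * norm (t x))"
        by (simp only: norm_mult complex_mod_cnj norm_of_real real_norm_def mult.commute[of \<eta>])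
    qed
    also have "\<dots> = \<eta> * (LINT x|ds. norm (d x) * norm (t x))" by simp
    also have "\<dots> \<le> \<eta> * (L2n d * L2n t)"
    proof (rule mult_left_mono[OF _ \<eta>])
      have "norm (weighted_inner ds (\<lambda>_. 1) (\<lambda>x. complex_of_real (norm (d x))) (\<lambda>x. complex_of_real (norm (t x))))
          \<le> unweighted.seminorm (\<lambda>x. complex_of_real (norm (d x))) *
             unweighted.seminorm (\<lambda>x. complex_of_real (norm (t x)))"
        by (intro unweighted.Cauchy_Schwarz abs_L2 L2)
      moreover have "weighted_inner ds (\<lambda>_. 1) (\<lambda>x. complex_of_real (norm (d x))) (\<lambda>x. complex_of_real (norm (t x)))
          = complex_of_real (LINT x|ds. norm (d x) * norm (t x))"
        unfolding integral_complex_of_real[symmetric] by (simp add: weighted_inner_def)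
      ultimately show "(LINT x|ds. norm (d x) * norm (t x)) \<le> L2n d * L2n t"
        by (simp add: L2n_eq[symmetric] L2_norm_def)
    qed
    finally show "c * (L2n d)\<^sup>2 \<le> \<eta> * L2n t * L2n d" by (simp add: mult_ac)
  qed (use \<eta> nonneg L2 in auto)
  have "cauchy_value n \<gamma> t z = cauchy_value n \<gamma> s z + cauchy_value n \<gamma> d z"
    using cauchy_value_add[OF L2(1,3) r(1,3)] by (simp add: d_def)
  then have "norm (szego_kernel \<Omega> n \<gamma> \<psi> z a - szego_kernel \<Omega> n \<gamma> \<phi> z a) = norm (cauchy_value n \<gamma> d z)"
    by (simp add: szego_kernel_def s_def t_def)
  also have "\<dots> \<le> K * L2n d"
    unfolding K_def by (rule cauchy_value_L2_bound[OF L2(3) r(1,3)])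
  also have "\<dots> \<le> K * (\<eta> * (K / c) / c)"
    using t_bound d_bound K \<eta> p.c_pos
    by (intro mult_left_mono order_trans[OF d_bound] divide_right_mono) auto
  finally show ?thesis by (simp add: K_def power2_eq_square mult_ac)
qed

end

theorem theorem4p1:
  fixes \<Omega> :: "complex set" and n :: nat and \<gamma> :: "nat \<Rightarrow> real \<Rightarrow> complex"
    and \<phi> :: "complex \<Rightarrow> real" and \<phi>s :: "nat \<Rightarrow> complex \<Rightarrow> real"
  assumes "smooth_domain n \<Omega>"
    and "oriented_boundary_parametrization n \<Omega> \<gamma>"
    and "smooth_on_boundary n \<gamma> \<phi>"
    and "\<And>z. z \<in> frontier \<Omega> \<Longrightarrow> \<phi> z > 0"
    and "\<And>k. smooth_on_boundary n \<gamma> (\<phi>s k)"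
    and "\<And>k z. z \<in> frontier \<Omega> \<Longrightarrow> \<phi>s k z > 0"
    and "uniform_limit (frontier \<Omega>) \<phi>s \<phi> sequentially"
  shows "\<forall>p \<in> \<Omega> \<times> \<Omega>. \<exists>U. open U \<and> p \<in> U \<and> U \<subseteq> \<Omega> \<times> \<Omega> \<and>
           uniform_limit U (\<lambda>k (z, w). szego_kernel \<Omega> n \<gamma> (\<phi>s k) z w)
             (\<lambda>(z, w). szego_kernel \<Omega> n \<gamma> \<phi> z w) sequentially"
proof
  interpret boundary \<Omega> n \<gamma>
    using assms(2) by unfold_locales (simp add: oriented_boundary_parametrization_def)
  have "open \<Omega>" using assms(1) by (simp add: smooth_domain_def)
  have cont: "continuous_on (frontier \<Omega>) \<phi>" "continuous_on (frontier \<Omega>) (\<phi>s k)" for k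
    by (intro smooth_on_boundary_imp_continuous assms)+
  obtain m where m: "m > 0" "\<And>\<zeta>. \<zeta> \<in> frontier \<Omega> \<Longrightarrow> m \<le> \<phi> \<zeta>"
  proof (cases "frontier \<Omega> = {}")
    case False
    then obtain \<zeta>0 where "\<zeta>0 \<in> frontier \<Omega>" "\<And>\<zeta>. \<zeta> \<in> frontier \<Omega> \<Longrightarrow> \<phi> \<zeta>0 \<le> \<phi> \<zeta>"
      using continuous_attains_inf[OF compact_frontier _ cont(1)] by blast
    then show ?thesis using that assms(4) by blast
  qed (use that[of 1] in simp)
  have "bounded (\<phi> ` frontier \<Omega>)"
    by (intro compact_imp_bounded compact_continuous_image cont compact_frontier)
  then obtain C where "\<And>\<zeta>. \<zeta> \<in> frontier \<Omega> \<Longrightarrow> \<bar>\<phi> \<zeta>\<bar> \<le> C" by (auto simp: bounded_iff)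
  then have C: "\<phi> \<zeta> \<le> C" if "\<zeta> \<in> frontier \<Omega>" for \<zeta> using that abs_le_D1 by blast
  \<comment> \<open>Half of a positive lower bound of \<open>\<phi>\<close>, which makes it a common lower bound for \<open>\<phi>\<close> and all weights uniformly within \<open>c\<close>
    of it.\<close>
  define c where "c = m / 2"
  have c: "c > 0" "m = 2 * c" using m(1) by (simp_all add: c_def)
  have weight: "weighted_measure ds \<phi> c (C + c)"
    using c C m(2) by unfold_locales (force simp: space_ds intro!: continuous_imp_measurable_ds cont)+
  have weights: "weighted_measure ds (\<phi>s k) c (C + c)"
    if "\<And>\<zeta>. \<zeta> \<in> frontier \<Omega> \<Longrightarrow> \<bar>\<phi> \<zeta> - \<phi>s k \<zeta>\<bar> \<le> c" for k
  proof
    show "\<phi>s k \<in> borel_measurable ds" by (rule continuous_imp_measurable_ds[OF cont(2)])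
    fix \<zeta> assume "\<zeta> \<in> space ds"
    then have "\<zeta> \<in> frontier \<Omega>" by (simp add: space_ds)
    from that[OF this] m(2)[OF this] C[OF this] c show "c \<le> \<phi>s k \<zeta>" "\<phi>s k \<zeta> \<le> C + c" by linarith+
  qed (rule c)
  fix p assume "p \<in> \<Omega> \<times> \<Omega>"
  then obtain z0 w0 where p: "p = (z0, w0)" "z0 \<in> \<Omega>" "w0 \<in> \<Omega>" by auto
  obtain r1 r2 where r12: "r1 > 0" "ball z0 r1 \<subseteq> \<Omega>" "r2 > 0" "ball w0 r2 \<subseteq> \<Omega>"
    using \<open>open \<Omega>\<close> p by (meson open_contains_ball)
  \<comment> \<open>Balls of twice the radius still fit into \<open>\<Omega>\<close>, so points of the smaller balls keep distance
    \<open>r\<close> from the boundary.\<close>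
  define r where "r = min r1 r2 / 2"
  have r: "r > 0" using r12 by (simp add: r_def)
  have sub: "ball z0 (2 * r) \<subseteq> \<Omega>" "ball w0 (2 * r) \<subseteq> \<Omega>"
    using r12 by (auto simp: r_def)
  have dist: "r \<le> dist \<zeta> z" if "ball x (2 * r) \<subseteq> \<Omega>" "z \<in> ball x r" "\<zeta> \<in> frontier \<Omega>" for x z \<zeta>
  proof -
    have "\<zeta> \<notin> ball x (2 * r)" using that \<open>open \<Omega>\<close> by (auto simp: frontier_def interior_open)
    then show ?thesis using that(2) dist_triangle[of x \<zeta> z] by (simp add: dist_commute)
  qed
  have lim: "uniform_limit (ball z0 r \<times> ball w0 r) (\<lambda>k (z, w). szego_kernel \<Omega> n \<gamma> (\<phi>s k) z w)
             (\<lambda>(z, w). szego_kernel \<Omega> n \<gamma> \<phi> z w) sequentially"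
  proof (rule uniform_limitI)
    fix e :: real assume "e > 0"
    define A where "A = (Cauchy_bound r / c)\<^sup>2"
    have A: "A \<ge> 0" by (simp add: A_def)
    define \<eta> where "\<eta> = min c (e / (A + 1))"
    have \<eta>: "\<eta> > 0" "\<eta> \<le> c" using c \<open>e > 0\<close> A by (simp_all add: \<eta>_def)
    have "A * \<eta> \<le> A * (e / (A + 1))" using A by (intro mult_left_mono) (simp_all add: \<eta>_def)
    also have "\<dots> < e" using A \<open>e > 0\<close> by (simp add: field_simps)
    finally have A\<eta>: "A * \<eta> < e" .
    have "\<forall>\<^sub>F k in sequentially. \<forall>\<zeta>\<in>frontier \<Omega>. dist (\<phi>s k \<zeta>) (\<phi> \<zeta>) < \<eta>"
      by (rule uniform_limitD[OF assms(7) \<eta>(1)])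
    then show "\<forall>\<^sub>F k in sequentially. \<forall>x\<in>ball z0 r \<times> ball w0 r.
      dist (case x of (z, w) \<Rightarrow> szego_kernel \<Omega> n \<gamma> (\<phi>s k) z w)
           (case x of (z, w) \<Rightarrow> szego_kernel \<Omega> n \<gamma> \<phi> z w) < e"
    proof eventually_elim
      case (elim k)
      have close: "\<bar>\<phi> \<zeta> - \<phi>s k \<zeta>\<bar> \<le> \<eta>" if "\<zeta> \<in> frontier \<Omega>" for \<zeta>
        using elim that by (force simp: dist_real_def)
      have wk: "weighted_measure ds (\<phi>s k) c (C + c)"
        using close \<eta>(2) by (intro weights) force
      have "norm (szego_kernel \<Omega> n \<gamma> (\<phi>s k) z w - szego_kernel \<Omega> n \<gamma> \<phi> z w) \<le> A * \<eta>"
        if "z \<in> ball z0 r" "w \<in> ball w0 r" for z w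
        unfolding A_def
        by (rule szego_kernel_weight_stability[OF weight wk close r dist[OF sub(2) that(2)]
              dist[OF sub(1) that(1)]]) (use \<eta> in simp_all)
      with A\<eta> show ?case by (force simp: dist_norm)
    qed
  qed
  have "ball z0 r \<subseteq> \<Omega>" "ball w0 r \<subseteq> \<Omega>" using sub r by force+
  then show "\<exists>U. open U \<and> p \<in> U \<and> U \<subseteq> \<Omega> \<times> \<Omega> \<and>
           uniform_limit U (\<lambda>k (z, w). szego_kernel \<Omega> n \<gamma> (\<phi>s k) z w)
             (\<lambda>(z, w). szego_kernel \<Omega> n \<gamma> \<phi> z w) sequentially"
    using lim r p by (intro exI[of _ "ball z0 r \<times> ball w0 r"]) (auto intro: open_Times)
qed

end
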